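(* Let the disturbances $w_t$ be chosen by an adversary from a bounded set $\Omega\subseteq\mathbb{R}^n$. Then the dynamic regret of MPC with $k$ predictions over horizon $T$ ($1\le k\le T$) satisfies $$\mathit{Reg}^A(\mathsf{MPC}_k) = O(\|F^k\|^2\, T + 1) = O(\lambda^{2k}\, T + 1),$$ where the constants in $O(\cdot)$ do not depend on $k$ or $T$.
   Context: System and cost: $x_{t+1} = A x_t + B u_t + w_t$ with $x_t\in\mathbb{R}^n$, $u_t\in\mathbb{R}^d$, given $x_0$, and for horizon $T\ge1$ the cost is $J(u,w) = \sum_{t=0}^{T-1} (x_t^\top Q x_t + u_t^\top R u_t) + x_T^\top Q_f x_T$. Standing assumptions: $Q,Q_f\succeq 0$, $R\succ 0$ (symmetric); $(A,B)$ is stabilizable, i.e. there is $K_0$ with $\rho(A-BK_0)<1$ ($\rho$ = spectral radius); $(A,Q)$ is detectable, i.e. $(A^\top,Q)$ is stabilizable. $P$ is the (unique positive semidefinite) solution of $P = Q + A^\top P A - A^\top P B(R + B^\top P B)^{-1} B^\top PA$; $F=A-B(R+B^\top PB)^{-1}B^\top PA$, which satisfies $\rho(F)<1$; $\lambda=\frac{1+\rho(F)}2<1$. $\|\cdot\|$ is the spectral norm. MPC with $k\ge1$ predictions (terminal weight $P$): at each step $t$, given $x_t, w_t,\dots,w_{t+k-1}$, compute $$(u_t,\dots,u_{t+k-1})=\arg\min_{u}\ \sum_{i=t}^{t+k-1}(x_i^\top Qx_i+u_i^\top Ru_i)+x_{t+k}^\top P x_{t+k}\quad\text{s.t. } x_{i+1}=Ax_i+Bu_i+w_i,\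 i=t,\dots,t+k-1,$$ and apply only $u_t$ (for horizon $T$, set $w_s=0$ for $s\ge T$). $J^{\mathsf{MPC}_k}(w)$ is the resulting cost $J$ for the disturbance sequence $w$. Dynamic regret: $$\mathit{Reg}^A(\mathsf{MPC}_k)=\sup_{w_0,\dots,w_{T-1}\in\Omega}\Big(J^{\mathsf{MPC}_k}(w)-\min_{u'_0,\dots,u'_{T-1}}J(u',w)\Big).$$ Notation: $f=O(g)$ means $|f|\le C\,g$ for a constant $C>0$ and all admissible $k$ and $T$. *)

theory Defs
  imports "HOL-Analysis.Analysis"
begin

section \<open>Matrices\<close>

definition pos_semidef :: "real^'n^'n \<Rightarrow> bool" where
  "pos_semidef M \<longleftrightarrow> transpose M = M \<and> (\<forall>x. 0 \<le> x \<bullet> (M *v x))"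

definition pos_def :: "real^'n^'n \<Rightarrow> bool" where
  "pos_def M \<longleftrightarrow> transpose M = M \<and> (\<forall>x. x \<noteq> 0 \<longrightarrow> 0 < x \<bullet> (M *v x))"

definition complex_eigenvalues :: "real^'n^'n \<Rightarrow> complex set" where
  "complex_eigenvalues M =
     {z. \<exists>v. v \<noteq> 0 \<and> map_matrix complex_of_real M *v v = z *s v}"

definition spectral_radius :: "real^'n^'n \<Rightarrow> real" where
  "spectral_radius M = Max (cmod ` complex_eigenvalues M)"

definition spectral_norm :: "real^'n^'m \<Rightarrow> real" where
  "spectral_norm M = onorm (\<lambda>x. M *v x)"

(* The overloaded power M ^ k on the type of matrices is the entrywise one
   and is not what is meant. *)
definition matrix_power :: "real^'n^'n \<Rightarrow> nat \<Rightarrow> real^'n^'n" where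
  "matrix_power M k = (((**) M) ^^ k) (mat 1)"

section \<open>Linear-quadratic control\<close>

definition stabilizable :: "real^'n^'n \<Rightarrow> real^'d^'n \<Rightarrow> bool" where
  "stabilizable A B \<longleftrightarrow> (\<exists>K. spectral_radius (A - B ** K) < 1)"

definition detectable :: "real^'n^'n \<Rightarrow> real^'n^'n \<Rightarrow> bool" where
  "detectable A Q \<longleftrightarrow> stabilizable (transpose A) Q"

definition riccati_gain ::
  "real^'n^'n \<Rightarrow> real^'d^'n \<Rightarrow> real^'d^'d \<Rightarrow> real^'n^'n \<Rightarrow> real^'n^'d" where
  "riccati_gain A B R P =
     matrix_inv (R + transpose B ** P ** B) ** transpose B ** P ** A"

definition solves_riccati ::
  "real^'n^'n \<Rightarrow> real^'d^'n \<Rightarrow> real^'n^'n \<Rightarrow> real^'d^'d \<Rightarrow> real^'n^'n \<Rightarrow> bool" where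
  "solves_riccati A B Q R P \<longleftrightarrow>
     P = Q + transpose A ** P ** A - transpose A ** P ** B ** riccati_gain A B R P"

(* Input and disturbance sequences are functions of absolute time;
   traj A B t x u w j is the state at time t + j when the state at time t is x. *)
primrec traj ::
  "real^'n^'n \<Rightarrow> real^'d^'n \<Rightarrow> nat \<Rightarrow> real^'n \<Rightarrow> (nat \<Rightarrow> real^'d) \<Rightarrow> (nat \<Rightarrow> real^'n)
    \<Rightarrow> nat \<Rightarrow> real^'n" where
  "traj A B t x u w 0 = x"
| "traj A B t x u w (Suc j) = A *v traj A B t x u w j + B *v u (t + j) + w (t + j)"

(* Cost of the times t, ..., t + k - 1 started at x, plus terminal weight S at time t + k. *)
definition window_cost ::
  "real^'n^'n \<Rightarrow> real^'d^'n \<Rightarrow> real^'n^'n \<Rightarrow> real^'d^'d \<Rightarrow> real^'n^'n \<Rightarrow> nat \<Rightarrow> nat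
    \<Rightarrow> real^'n \<Rightarrow> (nat \<Rightarrow> real^'d) \<Rightarrow> (nat \<Rightarrow> real^'n) \<Rightarrow> real" where
  "window_cost A B Q R S t k x u w =
     (\<Sum>j<k. traj A B t x u w j \<bullet> (Q *v traj A B t x u w j) + u (t + j) \<bullet> (R *v u (t + j)))
     + traj A B t x u w k \<bullet> (S *v traj A B t x u w k)"

definition total_cost ::
  "real^'n^'n \<Rightarrow> real^'d^'n \<Rightarrow> real^'n^'n \<Rightarrow> real^'d^'d \<Rightarrow> real^'n^'n \<Rightarrow> real^'n \<Rightarrow> nat
    \<Rightarrow> (nat \<Rightarrow> real^'d) \<Rightarrow> (nat \<Rightarrow> real^'n) \<Rightarrow> real" where
  "total_cost A B Q R Qf x0 T u w = window_cost A B Q R Qf 0 T x0 u w"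

section \<open>Model predictive control\<close>

(* Plans are families indexed exactly by t, ..., t + k - 1 (extensional functions),
   so that the minimizer is unique as a function. *)
definition mpc_plan ::
  "real^'n^'n \<Rightarrow> real^'d^'n \<Rightarrow> real^'n^'n \<Rightarrow> real^'d^'d \<Rightarrow> real^'n^'n \<Rightarrow> nat \<Rightarrow> nat
    \<Rightarrow> real^'n \<Rightarrow> (nat \<Rightarrow> real^'n) \<Rightarrow> nat \<Rightarrow> real^'d" where
  "mpc_plan A B Q R P k t x w =
     arg_min_on (\<lambda>u. window_cost A B Q R P t k x u w) ({t..<t+k} \<rightarrow>\<^sub>E UNIV)"

primrec mpc_state ::
  "real^'n^'n \<Rightarrow> real^'d^'n \<Rightarrow> real^'n^'n \<Rightarrow> real^'d^'d \<Rightarrow> real^'n^'n \<Rightarrow> nat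
    \<Rightarrow> real^'n \<Rightarrow> (nat \<Rightarrow> real^'n) \<Rightarrow> nat \<Rightarrow> real^'n" where
  "mpc_state A B Q R P k x0 w 0 = x0"
| "mpc_state A B Q R P k x0 w (Suc t) =
     A *v mpc_state A B Q R P k x0 w t
     + B *v mpc_plan A B Q R P k t (mpc_state A B Q R P k x0 w t) w t
     + w t"

definition mpc_control ::
  "real^'n^'n \<Rightarrow> real^'d^'n \<Rightarrow> real^'n^'n \<Rightarrow> real^'d^'d \<Rightarrow> real^'n^'n \<Rightarrow> nat
    \<Rightarrow> real^'n \<Rightarrow> (nat \<Rightarrow> real^'n) \<Rightarrow> nat \<Rightarrow> real^'d" where
  "mpc_control A B Q R P k x0 w t =
     mpc_plan A B Q R P k t (mpc_state A B Q R P k x0 w t) w t"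

(* The zero padding matters for MPC, whose prediction window may reach beyond the horizon. *)
definition disturbances :: "(real^'n) set \<Rightarrow> nat \<Rightarrow> (nat \<Rightarrow> real^'n) set" where
  "disturbances \<Omega> T = {w. (\<forall>t<T. w t \<in> \<Omega>) \<and> (\<forall>t\<ge>T. w t = 0)}"

(* The supremum is taken in the extended reals, so that a finite bound on the regret
   includes the boundedness of the set of regrets. The inner infimum is over a nonempty
   set of reals bounded below by 0 whenever Q, R and Qf are positive semidefinite, and is
   attained if moreover R is positive definite. *)
definition mpc_dynamic_regret ::
  "real^'n^'n \<Rightarrow> real^'d^'n \<Rightarrow> real^'n^'n \<Rightarrow> real^'d^'d \<Rightarrow> real^'n^'n \<Rightarrow> real^'n^'n
    \<Rightarrow> real^'n \<Rightarrow> (real^'n) set \<Rightarrow> nat \<Rightarrow> nat \<Rightarrow> ereal" where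
  "mpc_dynamic_regret A B Q R Qf P x0 \<Omega> k T =
     (SUP w \<in> disturbances \<Omega> T.
        ereal (total_cost A B Q R Qf x0 T (mpc_control A B Q R P k x0 w) w
               - (INF u. total_cost A B Q R Qf x0 T u w)))"

end

theory Submission
  imports Defs "HOL-Computational_Algebra.Fundamental_Theorem_Algebra"
begin

text \<open>Completing the square in the cost with terminal weight \<open>P\<close> writes it as a constant
  plus a sum of squares of the deviations of the controls from the optimal feedback
  \<open>u = - K x - G h\<close>, where \<open>h\<close> is a sum of the known future disturbances with powers of
  \<open>F\<^sup>T\<close> as coefficients. MPC truncates this sum after \<open>k\<close> terms, so its
  deviation is of order \<open>\<parallel>F\<^sup>k\<parallel>\<close> in each step. Replacing the terminal weight \<open>P\<close>
  by \<open>Qf\<close> changes the regret by a bounded amount only: the MPC states are bounded, and a competitor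
  can reach a large terminal state only by deviations whose cost outweighs the gain, by
  detectability. The spectral facts rest on the annihilation of every vector by a product of
  factors \<open>M - z\<close> with eigenvalues \<open>z\<close>.\<close>

section \<open>Spectral radius and powers\<close>

text \<open>The constant left by completing the square depends on the disturbances and the horizon,
  not on the controls. It cancels in every comparison, so no optimal control for \<open>Qf\<close>
  has to be computed. The obstacle is the exchange of the terminal weight, by which a competitor may
  save up to the \<open>P\<close>-form of its final state. Stability alone bounds this form by some
  multiple of the cost of the deviations, but the multiple has to be 1. With
  \<open>x = y + \<xi>\<close>, where \<open>y\<close> is the trajectory without deviation, the cost
  of the deviations equals the stage costs of \<open>\<xi>\<close> plus the \<open>P\<close>-form of
  its final value. The part quadratic in \<open>\<xi>\<close> therefore cancels exactly; only a
  cross term remains, and the stage costs absorb it after an output injection by detectability. The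
  same injection shows that \<open>F\<close> is stable. Rates are always taken strictly above the
  spectral radius, which leaves room for the polynomial factors of Jordan blocks without any normal
  form.\<close>

lemma matrix_poly_annihilates:
  fixes N :: "complex^'n^'n"
  shows "\<exists>p :: complex poly. p \<noteq> 0 \<and> (\<Sum>i\<le>degree p. coeff p i *s ((*v) N ^^ i) v) = 0"
proof -
  \<comment> \<open>This is the dimension over the reals, so the relation found below has real
    coefficients, which are then embedded into the complex numbers.\<close>
  let ?d = "DIM(complex^'n)"
  let ?f = "\<lambda>i. ((*v) N ^^ i) v"
  have "\<exists>c :: nat \<Rightarrow> complex. (\<exists>i\<le>?d. c i \<noteq> 0) \<and> (\<Sum>i\<le>?d. c i *s ?f i) = 0"
  \<comment> \<open>Dependence is a notion for sets: repeated iterates would make the image too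
    small to force it, but they give a relation directly.\<close>
  proof (cases "inj_on ?f {..?d}")
    case False
    then obtain i j where ij: "i \<le> ?d" "j \<le> ?d" "i \<noteq> j" "?f i = ?f j"
      unfolding inj_on_def by (metis atMost_iff)
    define c where "c l = (if l = i then 1 else if l = j then -1 else 0 :: complex)" for l
    have "c l *s ?f l = (if l = i then ?f i else 0) + (if l = j then - ?f j else 0)" for l
      using ij(3) by (auto simp: c_def vec_eq_iff)
    then have "(\<Sum>l\<le>?d. c l *s ?f l) = 0"
      using ij by (simp add: sum.distrib)
    moreover have "c i \<noteq> 0"
      by (simp add: c_def)
    ultimately show ?thesis
      using ij(1) by blast
  next
    case True
    then have "card (?f ` {..?d}) > ?d"
      by (simp add: card_image)
    then have "dependent (?f ` {..?d})"
      using dependent_biggerset by blast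
    then obtain u x where u: "x \<in> ?f ` {..?d}" "u x \<noteq> 0" "(\<Sum>x\<in>?f ` {..?d}. u x *\<^sub>R x) = 0"
      by (subst (asm) dependent_finite) auto
    define c where "c i = complex_of_real (u (?f i))" for i
    have "c i *s ?f i = u (?f i) *\<^sub>R ?f i" for i
      unfolding c_def by (simp add: vec_eq_iff complex_eq_iff)
    then have "(\<Sum>i\<le>?d. c i *s ?f i) = 0"
      using u(3) by (simp only: sum.reindex[OF True] o_def)
    moreover have "\<exists>i\<le>?d. c i \<noteq> 0"
      using u(1,2) unfolding c_def by auto
    ultimately show ?thesis
      by blast
  qed
  then obtain c :: "nat \<Rightarrow> complex" and i0
    where i0: "i0 \<le> ?d" "c i0 \<noteq> 0" and c: "(\<Sum>i\<le>?d. c i *s ?f i) = 0"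
    by blast
  define p where "p = (\<Sum>i\<le>?d. monom (c i) i)"
  have coeff: "coeff p i = (if i \<le> ?d then c i else 0)" for i
    unfolding p_def by (simp add: coeff_sum)
  then have "degree p \<le> ?d"
    by (intro degree_le) simp
  then have "(\<Sum>i\<le>degree p. coeff p i *s ?f i) = (\<Sum>i\<le>?d. coeff p i *s ?f i)"
    by (intro sum.mono_neutral_left) (auto simp: coeff_eq_0 not_le)
  also have "\<dots> = 0"
    using c by (simp add: coeff)
  finally show ?thesis
    using coeff[of i0] i0 by (intro exI[of _ p]) auto
qed

lemma funpow_shift_commute:
  fixes N :: "complex^'n^'n"
  shows "((*v) N ^^ i) (N *v v - z *s v) = ((*v) N ^^ Suc i) v - z *s ((*v) N ^^ i) v"
proof (induction i)
  case (Suc i)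
  then show ?case
    by (simp add: matrix_vector_mult_diff_distrib vector_scalar_commute)
qed simp

text \<open>As \<open>p\<close> is \<open>X * q - z * q\<close>, the factor \<open>N - z\<close> can
  be moved onto the vector. This removes one root in an induction on the degree.\<close>

lemma matrix_poly_linear_factor:
  fixes N :: "complex^'n^'n"
  assumes "p = [:-z, 1:] * q" "q \<noteq> 0"
  shows "(\<Sum>i\<le>degree p. coeff p i *s ((*v) N ^^ i) v)
    = (\<Sum>i\<le>degree q. coeff q i *s ((*v) N ^^ i) (N *v v - z *s v))"
proof -
  let ?f = "\<lambda>i. ((*v) N ^^ i) v"
  have p: "p = pCons 0 q - smult z q"
    using assms(1) by simp
  have "degree p = Suc (degree q)"
    unfolding assms(1) using assms(2) by (subst degree_mult_eq) auto
  then have "(\<Sum>i\<le>degree p. coeff p i *s ?f i)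
     = (\<Sum>i\<le>Suc (degree q). coeff (pCons 0 q) i *s ?f i) - (\<Sum>i\<le>Suc (degree q). z *s (coeff q i *s ?f i))"
    unfolding p by (simp add: sum_subtractf vector_sub_rdistrib del: sum.atMost_Suc)
  also have "(\<Sum>i\<le>Suc (degree q). coeff (pCons 0 q) i *s ?f i) = (\<Sum>i\<le>degree q. coeff q i *s ?f (Suc i))"
    by (subst sum.atMost_Suc_shift) simp
  also have "(\<Sum>i\<le>Suc (degree q). z *s (coeff q i *s ?f i)) = (\<Sum>i\<le>degree q. z *s (coeff q i *s ?f i))"
    by (simp add: coeff_eq_0)
  also have "(\<Sum>i\<le>degree q. coeff q i *s ?f (Suc i)) - (\<Sum>i\<le>degree q. z *s (coeff q i *s ?f i))
     = (\<Sum>i\<le>degree q. coeff q i *s (?f (Suc i) - z *s ?f i))"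
    by (simp add: sum_subtractf[symmetric] vec_eq_iff algebra_simps)
  finally show ?thesis
    by (simp only: funpow_shift_commute)
qed

text \<open>Scalar shifts of \<open>N\<close> commute. The innermost factor can thus be brought to
  the outside, where it is cancelled if it is injective.\<close>

lemma fold_shift_commute:
  fixes N :: "complex^'n^'n"
  shows "fold (\<lambda>z v. N *v v - z *s v) zs (N *v v - z *s v)
    = N *v fold (\<lambda>z v. N *v v - z *s v) zs v - z *s fold (\<lambda>z v. N *v v - z *s v) zs v"
proof (induction zs arbitrary: v)
  case (Cons a zs)
  have "N *v (N *v v - z *s v) - a *s (N *v v - z *s v)
      = N *v (N *v v - a *s v) - z *s (N *v v - a *s v)"
    by (simp add: matrix_vector_mult_diff_distrib vector_scalar_commute vec_eq_iff algebra_simps)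
  then show ?case
    by (simp only: fold_simps o_apply Cons.IH)
qed simp

text \<open>Linear factors of an annihilating polynomial that do not belong to eigenvalues act
  injectively and can be dropped.\<close>

lemma eigenvalue_factors_annihilate:
  fixes N :: "complex^'n^'n"
  shows "\<exists>zs. (\<forall>z\<in>set zs. \<exists>v. v \<noteq> 0 \<and> N *v v = z *s v)
    \<and> fold (\<lambda>z v. N *v v - z *s v) zs v = 0"
proof -
  have "\<exists>zs. (\<forall>z\<in>set zs. \<exists>v. v \<noteq> 0 \<and> N *v v = z *s v) \<and> fold (\<lambda>z v. N *v v - z *s v) zs v = 0"
    if "p \<noteq> 0" "(\<Sum>i\<le>degree p. coeff p i *s ((*v) N ^^ i) v) = 0" for p :: "complex poly"
    using that
  proof (induction "degree p" arbitrary: p v)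
    case 0
    then have "coeff p 0 *s v = 0" "coeff p 0 \<noteq> 0"
      by (auto simp: leading_coeff_0_iff[symmetric] simp del: leading_coeff_0_iff)
    then show ?case
      by (intro exI[of _ "[]"]) (auto simp: vec_eq_iff)
  next
    case (Suc d)
    then obtain z where "poly p z = 0"
      using fundamental_theorem_of_algebra[of p] by (auto simp: constant_degree)
    then obtain q where q: "p = [:-z, 1:] * q"
      using poly_eq_0_iff_dvd by blast
    have q0: "q \<noteq> 0"
      using q Suc.prems(1) by auto
    have "degree p = Suc (degree q)"
      unfolding q using q0 by (subst degree_mult_eq) auto
    then have "d = degree q"
      using Suc.hyps(2) by simp
    then obtain zs where zs: "\<forall>z\<in>set zs. \<exists>v. v \<noteq> 0 \<and> N *v v = z *s v"
      "fold (\<lambda>z v. N *v v - z *s v) zs (N *v v - z *s v) = 0"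
      using Suc.hyps(1)[of q "N *v v - z *s v"] q0 Suc.prems(2)
      unfolding matrix_poly_linear_factor[OF q q0] by blast
    show ?case
    proof (cases "\<exists>v. v \<noteq> 0 \<and> N *v v = z *s v")
      case True
      then show ?thesis
        using zs by (intro exI[of _ "z # zs"]) auto
    next
      case False
      then have "fold (\<lambda>z v. N *v v - z *s v) zs v = 0"
        using zs(2) unfolding fold_shift_commute by auto
      then show ?thesis
        using zs(1) by blast
    qed
  qed
  then show ?thesis
    using matrix_poly_annihilates[of N v] by blast
qed

text \<open>The remaining factors annihilate \<open>N *v v - z *s v\<close>, whose iterates are thus
  bounded by \<open>C * r ^ k\<close>. The norms of the iterates of \<open>v\<close> then obey a
  scalar recursion with factor \<open>cmod z < r\<close> and this forcing.\<close>

lemma funpow_bound_if_annihilated: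
  fixes N :: "complex^'n^'n"
  assumes "\<forall>z\<in>set zs. cmod z < r" "0 < r"
    and "fold (\<lambda>z v. N *v v - z *s v) zs v = 0"
  shows "\<exists>C. \<forall>k. norm (((*v) N ^^ k) v) \<le> C * r ^ k"
  using assms(1,3)
proof (induction zs arbitrary: v)
  case Nil
  have "((*v) N ^^ k) 0 = 0" for k
    by (induction k) auto
  then show ?case
    using Nil by (intro exI[of _ 0]) auto
next
  case (Cons z zs)
  then obtain C where C: "norm (((*v) N ^^ k) (N *v v - z *s v)) \<le> C * r ^ k" for k
    by force
  have z: "cmod z < r"
    using Cons by simp
  \<comment> \<open>\<open>D\<close> has to dominate the initial norm and to satisfy
    \<open>C \<le> D * (r - cmod z)\<close>, which closes the step from \<open>k\<close> to
    \<open>Suc k\<close>.\<close>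
  define D where "D = max (norm v) (C / (r - cmod z))"
  have "C \<le> D * (r - cmod z)"
    using z by (simp add: D_def max_def field_simps)
  have "norm (((*v) N ^^ k) v) \<le> D * r ^ k" for k
  proof (induction k)
    case 0
    then show ?case
      by (simp add: D_def)
  next
    case (Suc k)
    have "((*v) N ^^ Suc k) v = z *s ((*v) N ^^ k) v + ((*v) N ^^ k) (N *v v - z *s v)"
      by (simp only: funpow_shift_commute) simp
    then have "norm (((*v) N ^^ Suc k) v) \<le> norm (z *s ((*v) N ^^ k) v) + C * r ^ k"
      using C[of k] by (auto intro: norm_triangle_le)
    also have "norm (z *s ((*v) N ^^ k) v) = cmod z * norm (((*v) N ^^ k) v)"
      by (simp add: norm_vec_def norm_mult L2_set_right_distrib)
    also have "\<dots> \<le> cmod z * (D * r ^ k)"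
      using Suc by (intro mult_left_mono) auto
    also have "C * r ^ k \<le> D * (r - cmod z) * r ^ k"
      using \<open>C \<le> D * (r - cmod z)\<close> \<open>0 < r\<close> by (intro mult_right_mono) auto
    finally show ?case
      by (simp add: algebra_simps)
  qed
  then show ?case
    by blast
qed

section \<open>Complex eigenvalues of real matrices\<close>

definition complex_vec :: "real^'n \<Rightarrow> real^'n \<Rightarrow> complex^'n" where
  "complex_vec a b = (\<chi> i. Complex (a $ i) (b $ i))"

lemma map_matrix_mult_complex_vec:
  "map_matrix complex_of_real M *v complex_vec a b = complex_vec (M *v a) (M *v b)"
  by (simp add: complex_vec_def vec_eq_iff matrix_vector_mult_def map_matrix_def complex_eq_iff)

text \<open>An eigenvector \<open>a + i b\<close> becomes a pair of real vectors, on which real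
  quadratic forms can be evaluated.\<close>

lemma complex_eigenvalues_iff:
  fixes M :: "real^'n^'n"
  shows "z \<in> complex_eigenvalues M \<longleftrightarrow>
    (\<exists>a b. (a \<noteq> 0 \<or> b \<noteq> 0) \<and> M *v a = Re z *\<^sub>R a - Im z *\<^sub>R b \<and> M *v b = Im z *\<^sub>R a + Re z *\<^sub>R b)"
proof -
  have surj: "\<exists>a b. v = complex_vec a b" for v :: "complex^'n"
    by (rule exI[of _ "\<chi> i. Re (v $ i)"], rule exI[of _ "\<chi> i. Im (v $ i)"])
      (simp add: complex_vec_def vec_eq_iff)
  have nz: "complex_vec a b \<noteq> 0 \<longleftrightarrow> a \<noteq> 0 \<or> b \<noteq> 0" for a b :: "real^'n"
    by (auto simp: complex_vec_def vec_eq_iff complex_eq_iff)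
  have smult: "z *s complex_vec a b
      = complex_vec (Re z *\<^sub>R a - Im z *\<^sub>R b) (Im z *\<^sub>R a + Re z *\<^sub>R b)" for a b :: "real^'n"
    by (simp add: complex_vec_def vec_eq_iff complex_eq_iff algebra_simps)
  have eq: "complex_vec a b = complex_vec c d \<longleftrightarrow> a = c \<and> b = d" for a b c d :: "real^'n"
    by (auto simp: complex_vec_def vec_eq_iff)
  have ex: "(\<exists>v. \<Phi> v) \<longleftrightarrow> (\<exists>a b. \<Phi> (complex_vec a b))" for \<Phi> :: "complex^'n \<Rightarrow> bool"
  proof
    assume "\<exists>v. \<Phi> v"
    then obtain v where "\<Phi> v"
      by blast
    with surj[of v] show "\<exists>a b. \<Phi> (complex_vec a b)"
      by auto
  qed blast
  have "z \<in> complex_eigenvalues M \<longleftrightarrow> (\<exists>a b. complex_vec a b \<noteq> 0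
      \<and> map_matrix complex_of_real M *v complex_vec a b = z *s complex_vec a b)"
    unfolding complex_eigenvalues_def mem_Collect_eq by (rule ex)
  then show ?thesis
    by (simp only: nz smult map_matrix_mult_complex_vec eq)
qed

text \<open>A product of factors that annihilates a nonzero vector cannot be empty. Together with
  finiteness this gives meaning to the \<open>Max\<close> in \<open>spectral_radius\<close>.\<close>

lemma complex_eigenvalues_nonempty: "complex_eigenvalues M \<noteq> {}"
proof -
  let ?N = "map_matrix complex_of_real M"
  obtain zs where zs: "\<forall>z\<in>set zs. \<exists>v. v \<noteq> 0 \<and> ?N *v v = z *s v"
    "fold (\<lambda>z v. ?N *v v - z *s v) zs 1 = 0"
    using eigenvalue_factors_annihilate[of ?N 1] by blast
  have "zs \<noteq> []"
    using zs(2) by auto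
  then show ?thesis
    using zs(1) unfolding complex_eigenvalues_def by (cases zs) auto
qed

lemma complex_eigenvalues_det:
  fixes M :: "real^'n^'n"
  shows "z \<in> complex_eigenvalues M \<longleftrightarrow> det (map_matrix complex_of_real M - mat z) = 0"
proof -
  have mat_mult: "mat z *v v = z *s v" for v :: "complex^'n"
    by (simp add: vec_eq_iff matrix_vector_mult_def mat_def if_distrib[of "\<lambda>x. x * _"] cong: if_cong)
  have "z \<in> complex_eigenvalues M \<longleftrightarrow> \<not> (\<forall>v. (map_matrix complex_of_real M - mat z) *v v = 0 \<longrightarrow> v = 0)"
    unfolding complex_eigenvalues_def by (auto simp: matrix_vector_mult_diff_rdistrib mat_mult)
  then show ?thesis
    by (simp only: matrix_left_invertible_ker[symmetric] invertible_left_inverse[symmetric] invertible_det_nz) simp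
qed

lemma complex_eigenvalues_transpose: "complex_eigenvalues (transpose M) = complex_eigenvalues M"
proof -
  have "map_matrix complex_of_real (transpose M) - mat z = transpose (map_matrix complex_of_real M - mat z)" for z
    by (auto simp: vec_eq_iff transpose_def mat_def map_matrix_def)
  then have "z \<in> complex_eigenvalues (transpose M) \<longleftrightarrow> z \<in> complex_eigenvalues M" for z
    unfolding complex_eigenvalues_det by (simp only: det_transpose)
  then show ?thesis
    by blast
qed

lemma complex_eigenvalue_bounded:
  assumes "z \<in> complex_eigenvalues M"
  shows "cmod z \<le> onorm ((*v) (map_matrix complex_of_real M))"
proof -
  obtain v where v: "v \<noteq> 0" "map_matrix complex_of_real M *v v = z *s v"
    using assms unfolding complex_eigenvalues_def by blast
  have "cmod z * norm v = norm (z *s v)"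
    by (simp add: norm_vec_def norm_mult L2_set_right_distrib)
  also have "\<dots> \<le> onorm ((*v) (map_matrix complex_of_real M)) * norm v"
    unfolding v(2)[symmetric] by (intro onorm) auto
  finally show ?thesis
    using v(1) by simp
qed

text \<open>The spectrum is the zero set of the characteristic polynomial \<open>p\<close>. If
  \<open>p\<close> were zero, every number would be an eigenvalue, against the bound by the operator
  norm.\<close>

lemma finite_complex_eigenvalues: "finite (complex_eigenvalues M)"
proof -
  define p where "p = det (\<chi> i j. [:complex_of_real (M $ i $ j):] - (if i = j then [:0, 1:] else 0))"
  have p: "poly p z = det (map_matrix complex_of_real M - mat z)" for z
    unfolding p_def det_def
    by (simp add: poly_sum poly_prod mat_def map_matrix_def if_distrib[of "\<lambda>p. poly p z"] cong: if_cong)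
  have "p \<noteq> 0"
  proof
    assume "p = 0"
    then have "z \<in> complex_eigenvalues M" for z
      using p[of z] by (simp add: complex_eigenvalues_det)
    from complex_eigenvalue_bounded[OF this[of "complex_of_real (onorm ((*v) (map_matrix complex_of_real M)) + 1)"]]
    show False
      using onorm_pos_le[of "(*v) (map_matrix complex_of_real M)"] by auto
  qed
  then have "finite {z. poly p z = 0}"
    by (rule poly_roots_finite)
  then show ?thesis
    by (rule rev_finite_subset) (auto simp: complex_eigenvalues_det p)
qed

lemma spectral_radius_ge: "z \<in> complex_eigenvalues M \<Longrightarrow> cmod z \<le> spectral_radius M"
  unfolding spectral_radius_def by (simp add: finite_complex_eigenvalues)

lemma spectral_radius_less_iff: "spectral_radius M < r \<longleftrightarrow> (\<forall>z\<in>complex_eigenvalues M. cmod z < r)"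
  unfolding spectral_radius_def
  by (simp add: finite_complex_eigenvalues complex_eigenvalues_nonempty)

lemma spectral_radius_nonneg: "0 \<le> spectral_radius M"
  using complex_eigenvalues_nonempty[of M] spectral_radius_ge[of _ M] norm_ge_zero order_trans by blast

lemma spectral_radius_transpose: "spectral_radius (transpose M) = spectral_radius M"
  by (simp add: spectral_radius_def complex_eigenvalues_transpose)

section \<open>Growth of matrix powers\<close>

lemma matrix_power_mult_vec: "matrix_power M k *v x = ((*v) M ^^ k) x"
proof -
  have "((**) M ^^ k) N *v x = ((*v) M ^^ k) (N *v x)" for N
    by (induction k) (auto simp: matrix_vector_mul_assoc[symmetric])
  then show ?thesis
    by (simp add: matrix_power_def)
qed

lemma norm_mult_le_spectral_norm: "norm (M *v x) \<le> spectral_norm M * norm x"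
  unfolding spectral_norm_def by (intro onorm) auto

lemma spectral_norm_nonneg: "0 \<le> spectral_norm M"
  unfolding spectral_norm_def by (intro onorm_pos_le) auto

text \<open>Pair \<open>transpose M *v x\<close> with itself, move \<open>M\<close> across and
  divide. Powers of \<open>transpose F\<close> in the previews are thereby measured by norms of
  powers of \<open>F\<close>.\<close>

lemma norm_mult_transpose_le_spectral_norm: "norm (transpose M *v x) \<le> spectral_norm M * norm x"
proof -
  let ?y = "transpose M *v x"
  have "norm ?y * norm ?y = x \<bullet> (M *v ?y)"
    by (metis dot_lmul_matrix power2_norm_eq_inner power2_eq_square transpose_matrix_vector)
  also have "\<dots> \<le> norm x * (spectral_norm M * norm ?y)"
    using norm_cauchy_schwarz[of x "M *v ?y"] norm_mult_le_spectral_norm[of M ?y]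
    by (meson mult_left_mono norm_ge_zero order_trans)
  finally have "norm ?y * norm ?y \<le> (spectral_norm M * norm x) * norm ?y"
    by (simp add: mult_ac)
  then show ?thesis
    using spectral_norm_nonneg[of M] by (cases "norm ?y = 0") (auto simp: mult_le_cancel_right)
qed

text \<open>Annihilation yields a constant for one vector at a time; expansion in the standard basis
  makes it uniform.\<close>

lemma spectral_norm_matrix_power_bound:
  fixes M :: "real^'n^'n"
  assumes "spectral_radius M < r"
  shows "\<exists>C>0. \<forall>k. spectral_norm (matrix_power M k) \<le> C * r ^ k"
proof -
  let ?N = "map_matrix complex_of_real M"
  have "0 < r"
    using assms spectral_radius_nonneg[of M] by simp
  have "\<exists>C. \<forall>k. norm (((*v) M ^^ k) x) \<le> C * r ^ k" for x
  proof -
    obtain zs where zs: "\<forall>z\<in>set zs. \<exists>v. v \<noteq> 0 \<and> ?N *v v = z *s v"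
      "fold (\<lambda>z v. ?N *v v - z *s v) zs (complex_vec x 0) = 0"
      using eigenvalue_factors_annihilate by blast
    have "\<forall>z\<in>set zs. cmod z < r"
      using zs(1) assms unfolding spectral_radius_less_iff complex_eigenvalues_def by blast
    from funpow_bound_if_annihilated[OF this \<open>0 < r\<close> zs(2)]
    obtain C where C: "norm (((*v) ?N ^^ k) (complex_vec x 0)) \<le> C * r ^ k" for k
      by blast
    have "((*v) ?N ^^ k) (complex_vec x 0) = complex_vec (((*v) M ^^ k) x) 0" for k
      by (induction k) (auto simp: map_matrix_mult_complex_vec)
    moreover have "norm (complex_vec y 0) = norm y" for y :: "real^'n"
      by (simp add: complex_vec_def norm_vec_def L2_set_def cmod_def)
    ultimately show ?thesis
      using C by (intro exI[of _ C]) simp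
  qed
  then have "\<forall>x. \<exists>C. \<forall>k. norm (((*v) M ^^ k) x) \<le> C * r ^ k"
    by blast
  from choice[OF this] obtain C where C: "\<And>x k. norm (((*v) M ^^ k) x) \<le> C x * r ^ k"
    by blast
  define D where "D = (\<Sum>i\<in>UNIV. \<bar>C (axis i 1)\<bar>) + 1"
  have "norm (matrix_power M k *v x) \<le> D * r ^ k * norm x" for k x
  proof -
    have "matrix_power M k *v x = (\<Sum>i\<in>UNIV. x $ i *\<^sub>R (matrix_power M k *v axis i 1))"
    proof -
      have "x = (\<Sum>i\<in>UNIV. x $ i *\<^sub>R axis i 1)"
        using basis_expansion[of x] by (simp add: scalar_mult_eq_scaleR)
      then have "matrix_power M k *v x = matrix_power M k *v (\<Sum>i\<in>UNIV. x $ i *\<^sub>R axis i 1)"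
        by simp
      then show ?thesis
        by (simp add: linear_sum[OF matrix_vector_mul_linear] matrix_vector_mult_scaleR)
    qed
    also have "norm \<dots> \<le> (\<Sum>i\<in>UNIV. norm x * (\<bar>C (axis i 1)\<bar> * r ^ k))"
    proof (intro sum_norm_le)
      fix i
      have "norm (matrix_power M k *v axis i 1) \<le> \<bar>C (axis i 1)\<bar> * r ^ k"
        unfolding matrix_power_mult_vec using C[of k "axis i 1"] \<open>0 < r\<close>
        by (meson abs_ge_self mult_right_mono order_trans zero_le_power less_imp_le)
      moreover have "\<bar>x $ i\<bar> \<le> norm x"
        by (rule component_le_norm_cart)
      ultimately show "norm (x $ i *\<^sub>R (matrix_power M k *v axis i 1)) \<le> norm x * (\<bar>C (axis i 1)\<bar> * r ^ k)"
        by (simp add: mult_mono)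
    qed
    also have "\<dots> = (\<Sum>i\<in>UNIV. \<bar>C (axis i 1)\<bar>) * r ^ k * norm x"
      by (simp add: sum_distrib_left sum_distrib_right mult_ac)
    also have "\<dots> \<le> D * r ^ k * norm x"
      using \<open>0 < r\<close> by (simp add: D_def mult_right_mono)
    finally show ?thesis .
  qed
  then have "spectral_norm (matrix_power M k) \<le> D * r ^ k" for k
    unfolding spectral_norm_def by (intro onorm_le) auto
  moreover have "D > 0"
    unfolding D_def by (meson abs_ge_zero add_nonneg_pos sum_nonneg zero_less_one)
  ultimately show ?thesis
    by blast
qed

section \<open>Quadratic forms\<close>

declare transpose_matrix_vector [simp del]

lemma inner_matrix_transpose:
  fixes M :: "real^'n^'m"
  shows "x \<bullet> (transpose M *v y) = (M *v x) \<bullet> y"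
  using dot_lmul_matrix[of x "transpose M" y] by (simp add: vector_transpose_matrix)

lemma pos_semidef_inner_commute: "pos_semidef M \<Longrightarrow> x \<bullet> (M *v y) = y \<bullet> (M *v x)"
  using inner_matrix_transpose[of x M y] by (simp add: pos_semidef_def inner_commute)

lemma pos_semidef_nonneg: "pos_semidef M \<Longrightarrow> 0 \<le> x \<bullet> (M *v x)"
  by (simp add: pos_semidef_def)

lemma pos_def_imp_pos_semidef: "pos_def M \<Longrightarrow> pos_semidef M"
  unfolding pos_def_def pos_semidef_def
  by (metis inner_zero_left less_eq_real_def)

lemma quadratic_form_le: "\<bar>x \<bullet> (M *v y)\<bar> \<le> spectral_norm M * norm x * norm y"
proof -
  have "\<bar>x \<bullet> (M *v y)\<bar> \<le> norm x * norm (M *v y)"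
    by (rule Cauchy_Schwarz_ineq2)
  also have "\<dots> \<le> norm x * (spectral_norm M * norm y)"
    by (intro mult_left_mono norm_mult_le_spectral_norm) auto
  finally show ?thesis
    by (simp add: mult_ac)
qed

text \<open>Expand the form at \<^term>\<open>x - s *\<^sub>R (M *v x)\<close> with
  \<^term>\<open>s = 1 / (spectral_norm M + 1)\<close>.\<close>

lemma norm_pos_semidef_mult_le:
  assumes "pos_semidef M"
  shows "(norm (M *v x))\<^sup>2 \<le> (spectral_norm M + 1) * (x \<bullet> (M *v x))"
proof -
  define c where "c = spectral_norm M + 1"
  define y where "y = M *v x"
  have c: "0 < c"
    using spectral_norm_nonneg[of M] by (simp add: c_def)
  have "y \<bullet> (M *v y) \<le> spectral_norm M * norm y * norm y"
    using quadratic_form_le[of y M y] by simp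
  also have "\<dots> \<le> c * (norm y)\<^sup>2"
    by (simp add: c_def power2_eq_square algebra_simps)
  finally have y: "y \<bullet> (M *v y) \<le> c * (norm y)\<^sup>2" .
  have expand: "(x - s *\<^sub>R y) \<bullet> (M *v (x - s *\<^sub>R y)) = x \<bullet> y - 2 * s * (norm y)\<^sup>2 + s\<^sup>2 * (y \<bullet> (M *v y))" for s
    using pos_semidef_inner_commute[OF assms, of x y]
    by (simp add: matrix_vector_mult_diff_distrib matrix_vector_mult_scaleR inner_diff_left inner_diff_right
        y_def[symmetric] power2_norm_eq_inner power2_eq_square[of s] algebra_simps)
  have "0 \<le> (x - (1 / c) *\<^sub>R y) \<bullet> (M *v (x - (1 / c) *\<^sub>R y))"
    by (rule pos_semidef_nonneg[OF assms])
  also have "\<dots> = x \<bullet> y - 2 * (norm y)\<^sup>2 / c + y \<bullet> (M *v y) / c\<^sup>2"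
    by (simp add: expand power_divide)
  also have "y \<bullet> (M *v y) / c\<^sup>2 \<le> c * (norm y)\<^sup>2 / c\<^sup>2"
    by (intro divide_right_mono y) auto
  also have "c * (norm y)\<^sup>2 / c\<^sup>2 = (norm y)\<^sup>2 / c"
    using c by (simp add: power2_eq_square)
  finally have "(norm y)\<^sup>2 / c \<le> x \<bullet> y"
    by simp
  then have "(norm y)\<^sup>2 \<le> c * (x \<bullet> y)"
    using c by (simp add: field_simps)
  then show ?thesis
    by (simp only: c_def y_def)
qed

lemma invertible_if_pos_def:
  assumes "\<And>x. x \<noteq> 0 \<Longrightarrow> 0 < x \<bullet> (M *v x)"
  shows "invertible (M :: real^'n^'n)"
proof -
  have "\<forall>x. M *v x = 0 \<longrightarrow> x = 0"
    using assms by (metis inner_zero_right less_irrefl)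
  then show ?thesis
    unfolding invertible_left_inverse matrix_left_invertible_ker .
qed

lemma matrix_inv_mult_vec:
  fixes M :: "real^'n^'n"
  assumes "invertible M"
  shows "M *v (matrix_inv M *v x) = x" "matrix_inv M *v (M *v x) = x"
proof -
  have "M ** matrix_inv M = mat 1 \<and> matrix_inv M ** M = mat 1"
    unfolding matrix_inv_def using assms unfolding invertible_def by (rule someI_ex)
  then show "M *v (matrix_inv M *v x) = x" "matrix_inv M *v (M *v x) = x"
    by (simp_all add: matrix_vector_mul_assoc)
qed

text \<open>The inverse recovers \<open>x\<close> from \<open>M *v x\<close>, and the form bounds
  \<open>M *v x\<close>; no compactness argument enters.\<close>

lemma pos_def_coercive:
  assumes "pos_def M"
  shows "\<exists>c>0. \<forall>x. (norm x)\<^sup>2 \<le> c * (x \<bullet> (M *v x))"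
proof -
  have inv: "invertible M"
    using assms by (intro invertible_if_pos_def) (simp add: pos_def_def)
  define c where "c = (spectral_norm (matrix_inv M))\<^sup>2 * (spectral_norm M + 1)"
  have "(norm x)\<^sup>2 \<le> (c + 1) * (x \<bullet> (M *v x))" for x
  proof -
    have "(norm x)\<^sup>2 \<le> (spectral_norm (matrix_inv M) * norm (M *v x))\<^sup>2"
      using norm_mult_le_spectral_norm[of "matrix_inv M" "M *v x"]
      by (intro power_mono) (auto simp: matrix_inv_mult_vec[OF inv])
    also have "\<dots> \<le> (spectral_norm (matrix_inv M))\<^sup>2 * ((spectral_norm M + 1) * (x \<bullet> (M *v x)))"
      unfolding power_mult_distrib
      by (intro mult_left_mono norm_pos_semidef_mult_le pos_def_imp_pos_semidef assms) auto
    also have "\<dots> \<le> (c + 1) * (x \<bullet> (M *v x))"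
      using pos_semidef_nonneg[OF pos_def_imp_pos_semidef[OF assms], of x]
      by (simp add: c_def algebra_simps)
    finally show ?thesis .
  qed
  moreover have "0 < c + 1"
    using spectral_norm_nonneg[of M] by (auto simp: c_def intro!: add_nonneg_pos mult_nonneg_nonneg)
  ultimately show ?thesis
    by blast
qed

text \<open>Transposition preserves the spectrum and, \<open>Q\<close> being symmetric, turns the
  stabilized matrix into the error matrix of an observer that measures
  \<open>Q *v x\<close>.\<close>

lemma detectable_output_injection:
  assumes "detectable A Q" "pos_semidef Q"
  shows "\<exists>L. spectral_radius (A - L ** Q) < 1"
proof -
  obtain L where L: "spectral_radius (transpose A - Q ** L) < 1"
    using assms(1) unfolding detectable_def stabilizable_def by blast
  have "transpose (transpose A - Q ** L) = A - transpose L ** Q"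
    using assms(2)
    by (simp add: pos_semidef_def matrix_transpose_mul transpose_def vec_eq_iff matrix_matrix_mult_def mult.commute)
  then show ?thesis
    using L spectral_radius_transpose[of "transpose A - Q ** L"]
    by (intro exI[of _ "transpose L"]) simp
qed

section \<open>Stable linear recurrences\<close>

lemma transpose_matrix_power: "((*v) (transpose M) ^^ k) x = transpose (matrix_power M k) *v x"
proof (induction k arbitrary: x)
  case 0
  show ?case
    by (simp add: matrix_power_def)
next
  case (Suc k)
  have "matrix_power M (Suc k) = M ** matrix_power M k"
    by (simp add: matrix_power_def)
  then show ?case
    by (simp add: Suc funpow_Suc_right matrix_transpose_mul matrix_vector_mul_assoc[symmetric] del: funpow.simps(2))
qed

lemma linear_funpow_mult_vec: "linear ((*v) M ^^ k)" for M :: "real^'n^'n"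
  unfolding matrix_power_mult_vec[symmetric, abs_def] by (rule matrix_vector_mul_linear)

lemma stable_power_bound:
  assumes "spectral_radius M < 1"
  shows "\<exists>C r. 0 < C \<and> 0 \<le> r \<and> r < 1 \<and> (\<forall>k x. norm (((*v) M ^^ k) x) \<le> C * r ^ k * norm x)"
proof -
  define r where "r = (1 + spectral_radius M) / 2"
  obtain C where C: "0 < C" "\<And>k. spectral_norm (matrix_power M k) \<le> C * r ^ k"
    using spectral_norm_matrix_power_bound[of M r] assms by (auto simp: r_def)
  have "norm (((*v) M ^^ k) x) \<le> C * r ^ k * norm x" for k x
    unfolding matrix_power_mult_vec[symmetric]
    using norm_mult_le_spectral_norm[of "matrix_power M k" x] C(2)[of k]
    by (meson mult_right_mono norm_ge_zero order_trans)
  then show ?thesis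
    using C(1) assms spectral_radius_nonneg[of M] by (intro exI[of _ C] exI[of _ r]) (auto simp: r_def)
qed

lemma sum_power_le:
  fixes r :: real
  assumes "0 \<le> r" "r < 1"
  shows "(\<Sum>j<m. r ^ j) \<le> 1 / (1 - r)"
proof -
  have "(\<Sum>j<m. r ^ j) * (1 - r) = 1 - r ^ m"
    using one_diff_power_eq[of r m] by (simp add: mult.commute)
  also have "\<dots> \<le> 1"
    using assms by simp
  finally show ?thesis
    using assms by (simp add: field_simps)
qed

lemma stable_sum_bound:
  fixes M :: "real^'n^'n"
  assumes "spectral_radius M < 1"
  shows "\<exists>C>0. \<forall>m d D. (\<forall>j. norm (d j) \<le> D) \<longrightarrow> norm (\<Sum>j<m. ((*v) M ^^ j) (d j)) \<le> C * D"
proof -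
  obtain C r where C: "0 < C" "0 \<le> r" "r < 1" "\<And>k x. norm (((*v) M ^^ k) x) \<le> C * r ^ k * norm x"
    using stable_power_bound[OF assms] by blast
  have "norm (\<Sum>j<m. ((*v) M ^^ j) (d j)) \<le> C / (1 - r) * D" if d: "\<forall>j. norm (d j) \<le> D"
    for m D and d :: "nat \<Rightarrow> real^'n"
  proof -
    have "0 \<le> D"
      using d norm_ge_zero order_trans by blast
    have "norm (\<Sum>j<m. ((*v) M ^^ j) (d j)) \<le> (\<Sum>j<m. C * r ^ j * D)"
      using C d by (intro sum_norm_le order_trans[OF C(4)] mult_left_mono) auto
    also have "\<dots> = C * D * (\<Sum>j<m. r ^ j)"
      by (simp add: sum_distrib_left mult_ac)
    also have "\<dots> \<le> C * D * (1 / (1 - r))"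
      using sum_power_le[OF C(2,3)] C(1) \<open>0 \<le> D\<close> by (intro mult_left_mono) auto
    finally show ?thesis
      by (simp add: mult_ac)
  qed
  moreover have "0 < C / (1 - r)"
    using C by simp
  ultimately show ?thesis
    by blast
qed

text \<open>Variation of constants, with the most recent forcing at \<open>j = 0\<close>.\<close>

lemma linear_recurrence:
  fixes M :: "real^'n^'n"
  assumes "\<And>t. t < T \<Longrightarrow> x (Suc t) = M *v x t + d t" "t \<le> T"
  shows "x t = ((*v) M ^^ t) (x 0) + (\<Sum>j<t. ((*v) M ^^ j) (d (t - Suc j)))"
  using assms(2)
proof (induction t)
  case (Suc t)
  have "(\<Sum>j<Suc t. ((*v) M ^^ j) (d (Suc t - Suc j))) = d t + M *v (\<Sum>j<t. ((*v) M ^^ j) (d (t - Suc j)))"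
    by (subst sum.lessThan_Suc_shift) (simp add: linear_sum[OF matrix_vector_mul_linear])
  then show ?case
    using Suc assms(1)[of t] by (simp add: matrix_vector_right_distrib)
qed simp

lemma stable_recurrence_bound:
  fixes M :: "real^'n^'n"
  assumes "spectral_radius M < 1"
  shows "\<exists>C>0. \<forall>x d D. (\<forall>t. x (Suc t) = M *v x t + d t) \<and> (\<forall>t. norm (d t) \<le> D)
    \<longrightarrow> (\<forall>t. norm (x t) \<le> C * (norm (x 0) + D))"
proof -
  obtain C r where C: "0 < C" "0 \<le> r" "r < 1" "\<And>k x. norm (((*v) M ^^ k) x) \<le> C * r ^ k * norm x"
    using stable_power_bound[OF assms] by blast
  obtain C' where C': "0 < C'"
    "\<And>m d D. (\<forall>j. norm (d j) \<le> D) \<Longrightarrow> norm (\<Sum>j<m. ((*v) M ^^ j) (d j)) \<le> C' * D"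
    using stable_sum_bound[OF assms] by blast
  have "norm (x t) \<le> (C + C') * (norm (x 0) + D)"
    if x: "\<forall>t. x (Suc t) = M *v x t + d t" and d: "\<forall>t. norm (d t) \<le> D" for x d D t
  proof -
    have "0 \<le> D"
      using d norm_ge_zero order_trans by blast
    have "norm (x t) \<le> norm (((*v) M ^^ t) (x 0)) + norm (\<Sum>j<t. ((*v) M ^^ j) (d (t - Suc j)))"
      using x by (subst linear_recurrence[of t x M d]) (auto intro: norm_triangle_ineq)
    also have "norm (((*v) M ^^ t) (x 0)) \<le> C * r ^ t * norm (x 0)"
      by (rule C(4))
    also have "\<dots> \<le> C * norm (x 0)"
      using C power_le_one[of r t] by (intro mult_right_mono mult_left_le) auto
    also have "norm (\<Sum>j<t. ((*v) M ^^ j) (d (t - Suc j))) \<le> C' * D"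
      using d by (intro C'(2)) simp
    also have "C * norm (x 0) + C' * D \<le> (C + C') * (norm (x 0) + D)"
      using C(1) C'(1) \<open>0 \<le> D\<close> by (simp add: algebra_simps)
    finally show ?thesis
      by simp
  qed
  moreover have "0 < C + C'"
    using C(1) C'(1) by simp
  ultimately show ?thesis
    by blast
qed

text \<open>The solution is a convolution with a geometrically decaying kernel, so Cauchy-Schwarz
  gives a constant independent of \<open>T\<close>. Square sums are the right measure of the forcing
  because total stage costs control only these.\<close>

lemma stable_recurrence_square_sum_bound:
  fixes M :: "real^'n^'n"
  assumes "spectral_radius M < 1"
  shows "\<exists>C>0. \<forall>x d T. x 0 = 0 \<and> (\<forall>t<T. x (Suc t) = M *v x t + d t)
    \<longrightarrow> (norm (x T))\<^sup>2 \<le> C * (\<Sum>t<T. (norm (d t))\<^sup>2)"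
proof -
  obtain C r where C: "0 < C" "0 \<le> r" "r < 1" "\<And>k x. norm (((*v) M ^^ k) x) \<le> C * r ^ k * norm x"
    using stable_power_bound[OF assms] by blast
  have r2: "0 \<le> r\<^sup>2" "r\<^sup>2 < 1"
    using C by (auto simp: power_less_one_iff abs_square_less_1)
  have "(norm (x T))\<^sup>2 \<le> C\<^sup>2 / (1 - r\<^sup>2) * (\<Sum>t<T. (norm (d t))\<^sup>2)"
    if x: "x 0 = 0" "\<forall>t<T. x (Suc t) = M *v x t + d t" for x d T
  proof -
    have "x T = (\<Sum>j<T. ((*v) M ^^ j) (d (T - Suc j)))"
      using linear_recurrence[of T x M d T] x linear_0[OF linear_funpow_mult_vec[of T M]] by simp
    then have "norm (x T) \<le> (\<Sum>j<T. C * r ^ j * norm (d (T - Suc j)))"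
      by (simp add: sum_norm_le C(4))
    then have "(norm (x T))\<^sup>2 \<le> (\<Sum>j<T. C * r ^ j * norm (d (T - Suc j)))\<^sup>2"
      by (intro power_mono) auto
    also have "\<dots> \<le> (\<Sum>j<T. (C * r ^ j)\<^sup>2) * (\<Sum>j<T. (norm (d (T - Suc j)))\<^sup>2)"
      by (rule Cauchy_Schwarz_ineq_sum)
    also have "(\<Sum>j<T. (norm (d (T - Suc j)))\<^sup>2) = (\<Sum>t<T. (norm (d t))\<^sup>2)"
      by (rule sum.nat_diff_reindex)
    also have "(\<Sum>j<T. (C * r ^ j)\<^sup>2) = C\<^sup>2 * (\<Sum>j<T. (r\<^sup>2) ^ j)"
      by (simp add: sum_distrib_left power_mult_distrib power_mult[symmetric] mult.commute)
    also have "\<dots> \<le> C\<^sup>2 * (1 / (1 - r\<^sup>2))"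
      using sum_power_le[OF r2] by (intro mult_left_mono) auto
    finally show ?thesis
      by (simp add: mult_right_mono sum_nonneg)
  qed
  moreover have "0 < C\<^sup>2 / (1 - r\<^sup>2)"
    using C(1) r2 by simp
  ultimately show ?thesis
    by blast
qed

section \<open>Completing the square\<close>

text \<open>\<open>traj\<close> appends steps at its end, while dynamic programming peels off the
  first one.\<close>

lemma traj_Suc_shift:
  "traj A B t x u w (Suc j) = traj A B (Suc t) (A *v x + B *v u t + w t) u w j"
  by (induction j) auto

lemma window_cost_Suc:
  "window_cost A B Q R S t (Suc k) x u w = x \<bullet> (Q *v x) + u t \<bullet> (R *v u t)
    + window_cost A B Q R S (Suc t) k (A *v x + B *v u t + w t) u w"
  unfolding window_cost_def by (subst sum.lessThan_Suc_shift) (simp add: traj_Suc_shift del: traj.simps(2))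

section \<open>Cost-to-go for the Riccati solution\<close>

locale riccati_solution =
  fixes A Q P :: "real^'n^'n" and B :: "real^'d^'n" and R :: "real^'d^'d"
  assumes Q: "pos_semidef Q" and R: "pos_def R" and P: "pos_semidef P"
    and riccati: "solves_riccati A B Q R P"
begin

text \<open>Half the Hessian in the control of the one-step cost followed by the weight
  \<open>P\<close>.\<close>

definition S :: "real^'d^'d" where
  "S = R + transpose B ** P ** B"

definition K :: "real^'n^'d" where
  "K = riccati_gain A B R P"

definition F :: "real^'n^'n" where
  "F = A - B ** K"

definition G :: "real^'n^'d" where
  "G = matrix_inv S ** transpose B"

text \<open>The linear term of the cost-to-go at time \<open>t\<close> with \<open>k\<close> known disturbances is
  \<open>2 * ((F *v x) \<bullet> preview w t k)\<close>.\<close>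

definition preview :: "(nat \<Rightarrow> real^'n) \<Rightarrow> nat \<Rightarrow> nat \<Rightarrow> real^'n" where
  "preview w t k = (\<Sum>j<k. ((*v) (transpose F) ^^ j) (P *v w (t + j)))"

definition deviation :: "real^'n \<Rightarrow> real^'n \<Rightarrow> real^'d \<Rightarrow> real^'d" where
  "deviation h x u = u + K *v x + G *v h"

lemma S_mult_vec: "S *v x = R *v x + transpose B *v (P *v (B *v x))"
  by (simp add: S_def matrix_vector_mult_add_rdistrib matrix_vector_mul_assoc[symmetric])

lemma inner_S: "x \<bullet> (S *v y) = x \<bullet> (R *v y) + (B *v x) \<bullet> (P *v (B *v y))"
  by (simp add: S_mult_vec inner_add_right inner_matrix_transpose)

lemma S_inner_commute: "x \<bullet> (S *v y) = y \<bullet> (S *v x)"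
  unfolding inner_S
  using pos_semidef_inner_commute[OF P] pos_semidef_inner_commute[OF pos_def_imp_pos_semidef[OF R]] by metis

lemma S_pos: "x \<noteq> 0 \<Longrightarrow> 0 < x \<bullet> (S *v x)"
  unfolding inner_S using R pos_semidef_nonneg[OF P, of "B *v x"]
  by (simp add: pos_def_def add_pos_nonneg)

lemma S_nonneg: "0 \<le> x \<bullet> (S *v x)"
  using S_pos[of x] by (cases "x = 0") auto

lemma S_invertible: "invertible S"
  using S_pos by (rule invertible_if_pos_def)

lemma S_K: "S *v (K *v x) = transpose B *v (P *v (A *v x))"
proof -
  have "K *v x = matrix_inv S *v (transpose B *v (P *v (A *v x)))"
    by (simp add: K_def riccati_gain_def S_def matrix_vector_mul_assoc[symmetric])
  then show ?thesis
    by (simp add: matrix_inv_mult_vec[OF S_invertible])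
qed

lemma S_G: "S *v (G *v x) = transpose B *v x"
  by (simp add: G_def matrix_vector_mul_assoc[symmetric] matrix_inv_mult_vec[OF S_invertible])

lemma F_mult_vec: "F *v x = A *v x - B *v (K *v x)"
  by (simp add: F_def matrix_vector_mult_diff_rdistrib matrix_vector_mul_assoc)

lemma riccati_form:
  "x \<bullet> (P *v x) = x \<bullet> (Q *v x) + (A *v x) \<bullet> (P *v (A *v x)) - (A *v x) \<bullet> (P *v (B *v (K *v x)))"
proof -
  have "P *v x = (Q + transpose A ** P ** A - transpose A ** P ** B ** K) *v x"
    using riccati by (simp add: solves_riccati_def K_def)
  also have "\<dots> = Q *v x + transpose A *v (P *v (A *v x)) - transpose A *v (P *v (B *v (K *v x)))"
    by (simp add: matrix_vector_mult_diff_rdistrib matrix_vector_mult_add_rdistrib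
        matrix_vector_mul_assoc[symmetric])
  finally show ?thesis
    by (simp only: inner_add_right inner_diff_right inner_matrix_transpose)
qed

text \<open>Up to a constant, \<open>y \<bullet> (P *v y) + 2 * (y \<bullet> p)\<close> is the
  cost-to-go after the step. Minimizing over \<open>u\<close> preserves this shape: the Riccati
  equation reproduces \<open>P\<close>, and the linear term \<open>h\<close> is pulled back by
  \<open>F\<close>, which is the origin of the recursion for \<open>preview\<close>.\<close>

lemma completed_square_step:
  fixes x w p :: "real^'n" and u :: "real^'d"
  defines "h \<equiv> P *v w + p" and "y \<equiv> A *v x + B *v u + w"
  shows "x \<bullet> (Q *v x) + u \<bullet> (R *v u) + y \<bullet> (P *v y) + 2 * (y \<bullet> p)
    = x \<bullet> (P *v x) + 2 * ((F *v x) \<bullet> h) + (w \<bullet> (P *v w) + 2 * (w \<bullet> p) - (B *v (G *v h)) \<bullet> h)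
      + deviation h x u \<bullet> (S *v deviation h x u)"
proof -
  define a b c g where "a = A *v x" and "b = B *v u" and "c = B *v (K *v x)" and "g = B *v (G *v h)"
  have "deviation h x u \<bullet> (S *v deviation h x u) = u \<bullet> (S *v u) + (K *v x) \<bullet> (S *v (K *v x))
      + (G *v h) \<bullet> (S *v (G *v h)) + 2 * (u \<bullet> (S *v (K *v x))) + 2 * (u \<bullet> (S *v (G *v h)))
      + 2 * ((K *v x) \<bullet> (S *v (G *v h)))"
    unfolding deviation_def matrix_vector_right_distrib inner_add_left inner_add_right
    using S_inner_commute[of u "K *v x"] S_inner_commute[of u "G *v h"] S_inner_commute[of "K *v x" "G *v h"]
    by simp
  \<comment> \<open>\<open>S_K\<close> and \<open>S_G\<close> evaluate \<open>S\<close> on the gains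
    and so remove its inverse.\<close>
  also have "\<dots> = u \<bullet> (R *v u) + b \<bullet> (P *v b) + c \<bullet> (P *v a) + g \<bullet> h
      + 2 * (b \<bullet> (P *v a)) + 2 * (b \<bullet> h) + 2 * (c \<bullet> h)"
    unfolding S_K S_G inner_matrix_transpose inner_S[of u u] a_def b_def c_def g_def by simp
  finally have dev: "deviation h x u \<bullet> (S *v deviation h x u) = \<dots>" .
  note sym = pos_semidef_inner_commute[OF P]
  have "y = a + b + w" "F *v x = a - c"
    by (simp_all add: y_def a_def b_def c_def F_mult_vec)
  moreover have "x \<bullet> (P *v x) = x \<bullet> (Q *v x) + a \<bullet> (P *v a) - a \<bullet> (P *v c)"
    unfolding a_def c_def by (rule riccati_form)
  ultimately show ?thesis
    unfolding dev g_def[symmetric]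
    using sym[of c a] sym[of b a] sym[of w a] sym[of w b]
    by (simp add: h_def matrix_vector_right_distrib inner_add_left inner_add_right inner_diff_left)
qed

lemma preview_0: "preview w t 0 = 0"
  by (simp add: preview_def)

lemma preview_Suc: "preview w t (Suc k) = P *v w t + transpose F *v preview w (Suc t) k"
  unfolding preview_def
  by (subst sum.lessThan_Suc_shift) (simp add: linear_sum[OF matrix_vector_mul_linear])

text \<open>Induction on the window length with \<open>t\<close> arbitrary. The constant is
  quantified before \<open>x\<close> and \<open>u\<close>, which makes the costs of different
  controls comparable. At offset \<open>j\<close> there remain \<open>k - j\<close> known
  disturbances.\<close>

lemma window_cost_completed_square:
  "\<exists>c. \<forall>x u. window_cost A B Q R P t k x u w = x \<bullet> (P *v x) + 2 * ((F *v x) \<bullet> preview w t k) + c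
    + (\<Sum>j<k. let e = deviation (preview w (t + j) (k - j)) (traj A B t x u w j) (u (t + j)) in e \<bullet> (S *v e))"
proof (induction k arbitrary: t)
  case 0
  show ?case
    by (intro exI[of _ 0]) (simp add: window_cost_def preview_0)
next
  case (Suc k)
  let ?h = "preview w t (Suc k)"
  obtain c where c: "\<And>x u. window_cost A B Q R P (Suc t) k x u w
    = x \<bullet> (P *v x) + 2 * ((F *v x) \<bullet> preview w (Suc t) k) + c
    + (\<Sum>j<k. let e = deviation (preview w (Suc t + j) (k - j)) (traj A B (Suc t) x u w j) (u (Suc t + j))
        in e \<bullet> (S *v e))"
    using Suc.IH[of "Suc t"] by blast
  \<comment> \<open>Moving \<open>F\<close> across the inner product makes the linear term of the
    tail one in the successor state, as \<open>completed_square_step\<close> expects.\<close>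
  define p where "p = transpose F *v preview w (Suc t) k"
  have h: "?h = P *v w t + p"
    by (simp add: preview_Suc p_def)
  have *: "(F *v y) \<bullet> preview w (Suc t) k = y \<bullet> p" for y
    by (simp add: p_def inner_matrix_transpose)
  show ?case
  proof (intro exI allI)
    fix x u
    let ?y = "A *v x + B *v u t + w t"
    have "window_cost A B Q R P t (Suc k) x u w = (x \<bullet> (Q *v x) + u t \<bullet> (R *v u t)
        + ?y \<bullet> (P *v ?y) + 2 * (?y \<bullet> p)) + c
        + (\<Sum>j<k. let e = deviation (preview w (Suc t + j) (k - j)) (traj A B (Suc t) ?y u w j) (u (Suc t + j))
            in e \<bullet> (S *v e))"
      by (simp only: window_cost_Suc c *)
    also have "(\<Sum>j<k. let e = deviation (preview w (Suc t + j) (k - j)) (traj A B (Suc t) ?y u w j) (u (Suc t + j))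
            in e \<bullet> (S *v e)) = (\<Sum>j<Suc k. let e = deviation (preview w (t + j) (Suc k - j)) (traj A B t x u w j) (u (t + j))
        in e \<bullet> (S *v e)) - deviation ?h x (u t) \<bullet> (S *v deviation ?h x (u t))"
      by (subst sum.lessThan_Suc_shift) (simp add: traj_Suc_shift Let_def del: traj.simps(2))
    finally show "window_cost A B Q R P t (Suc k) x u w = x \<bullet> (P *v x) + 2 * ((F *v x) \<bullet> ?h)
        + (c + (w t \<bullet> (P *v w t) + 2 * (w t \<bullet> p) - (B *v (G *v ?h)) \<bullet> ?h))
        + (\<Sum>j<Suc k. let e = deviation (preview w (t + j) (Suc k - j)) (traj A B t x u w j) (u (t + j))
            in e \<bullet> (S *v e))"
      unfolding completed_square_step h by simp
  qed
qed

section \<open>Stability of the closed loop\<close>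

lemma lyapunov_form:
  "x \<bullet> (P *v x) = x \<bullet> (Q *v x) + (K *v x) \<bullet> (R *v (K *v x)) + (F *v x) \<bullet> (P *v (F *v x))"
proof -
  have "B *v (- (K *v x)) = - (B *v (K *v x))" "R *v (- (K *v x)) = - (R *v (K *v x))"
    by (simp_all add: linear_neg[OF matrix_vector_mul_linear])
  \<comment> \<open>The control \<open>- (K *v x)\<close> has deviation zero when there are no
    disturbances, so the square vanishes.\<close>
  then show ?thesis
    using completed_square_step[of x "- (K *v x)" 0 0] by (simp add: deviation_def F_mult_vec)
qed

text \<open>For an eigenvalue of modulus at least 1 the \<open>P\<close>-form cannot decrease under
  \<open>F\<close> on the real pair of its eigenvector. The Lyapunov identity then forces
  \<open>Q *v x = 0\<close> and \<open>K *v x = 0\<close> there, so \<open>F\<close> agrees with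
  \<open>A - L ** Q\<close> on the pair and the eigenvalue belongs to a stable matrix.\<close>

lemma spectral_radius_closed_loop:
  assumes "detectable A Q"
  shows "spectral_radius F < 1"
proof -
  obtain L where L: "spectral_radius (A - L ** Q) < 1"
    using detectable_output_injection[OF assms Q] by blast
  have "cmod z < 1" if eig: "z \<in> complex_eigenvalues F" for z
  proof (rule ccontr)
    assume "\<not> cmod z < 1"
    then have z: "1 \<le> (Re z)\<^sup>2 + (Im z)\<^sup>2"
      by (simp add: cmod_def)
    obtain a b where ab: "a \<noteq> 0 \<or> b \<noteq> 0" and Fa: "F *v a = Re z *\<^sub>R a - Im z *\<^sub>R b"
      and Fb: "F *v b = Im z *\<^sub>R a + Re z *\<^sub>R b"
      using eig unfolding complex_eigenvalues_iff by auto
    let ?p = "\<lambda>x. x \<bullet> (P *v x)"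
    \<comment> \<open>The cross terms in \<open>a\<close> and \<open>b\<close> cancel because
      \<open>P\<close> is symmetric, as for a Hermitian form at \<open>a + i b\<close>.\<close>
    have "?p (F *v a) + ?p (F *v b) = ((Re z)\<^sup>2 + (Im z)\<^sup>2) * (?p a + ?p b)"
      using pos_semidef_inner_commute[OF P, of a b]
      by (simp add: Fa Fb matrix_vector_mult_diff_distrib matrix_vector_right_distrib matrix_vector_mult_scaleR
          inner_add_left inner_add_right inner_diff_left inner_diff_right power2_eq_square algebra_simps)
    moreover have "1 * (?p a + ?p b) \<le> ((Re z)\<^sup>2 + (Im z)\<^sup>2) * (?p a + ?p b)"
      using z pos_semidef_nonneg[OF P] by (intro mult_right_mono add_nonneg_nonneg) auto
    ultimately have "?p a + ?p b \<le> ?p (F *v a) + ?p (F *v b)"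
      by simp
    then have le: "(a \<bullet> (Q *v a) + (K *v a) \<bullet> (R *v (K *v a))) + (b \<bullet> (Q *v b) + (K *v b) \<bullet> (R *v (K *v b))) \<le> 0"
      using lyapunov_form[of a] lyapunov_form[of b] by linarith
    have nn: "0 \<le> x \<bullet> (Q *v x)" "0 \<le> v \<bullet> (R *v v)" for x v
      using pos_semidef_nonneg[OF Q] pos_semidef_nonneg[OF pos_def_imp_pos_semidef[OF R]] by auto
    have zero: "x \<bullet> (Q *v x) = 0 \<and> (K *v x) \<bullet> (R *v (K *v x)) = 0" if "x = a \<or> x = b" for x
      using le nn(1)[of a] nn(1)[of b] nn(2)[of "K *v a"] nn(2)[of "K *v b"] that by auto
    have "A *v x - L *v (Q *v x) = F *v x" if "x = a \<or> x = b" for x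
    proof -
      have "Q *v x = 0"
        using norm_pos_semidef_mult_le[OF Q, of x] zero[OF that] by simp
      moreover have "K *v x = 0"
        using zero[OF that] R unfolding pos_def_def by (metis less_irrefl)
      ultimately show ?thesis
        by (simp add: F_mult_vec)
    qed
    then have "(A - L ** Q) *v x = F *v x" if "x = a \<or> x = b" for x
      using that by (simp add: matrix_vector_mult_diff_rdistrib matrix_vector_mul_assoc)
    then have "z \<in> complex_eigenvalues (A - L ** Q)"
      unfolding complex_eigenvalues_iff using ab Fa Fb by (intro exI[of _ a] exI[of _ b]) simp
    then show False
      using L \<open>\<not> cmod z < 1\<close> unfolding spectral_radius_less_iff by blast
  qed
  then show ?thesis
    by (simp add: spectral_radius_less_iff)
qed

text \<open>The closed-loop feedback makes all squares in the cost zero, hence so does every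
  minimizer. The square at \<open>j = 0\<close> belongs to the control that is applied.\<close>

lemma mpc_plan_eq:
  assumes "1 \<le> k"
  shows "deviation (preview w t k) x (mpc_plan A B Q R P k t x w t) = 0"
proof -
  let ?J = "\<lambda>u. window_cost A B Q R P t k x u w"
  let ?U = "{t..<t+k} \<rightarrow>\<^sub>E (UNIV :: (real^'d) set)"
  define E where "E u j = deviation (preview w (t + j) (k - j)) (traj A B t x u w j) (u (t + j))" for u j
  obtain c' where c': "?J u = x \<bullet> (P *v x) + 2 * ((F *v x) \<bullet> preview w t k) + c'
    + (\<Sum>j<k. E u j \<bullet> (S *v E u j))" for u
    using window_cost_completed_square[of t k w] unfolding E_def Let_def by blast
  define c where "c = x \<bullet> (P *v x) + 2 * ((F *v x) \<bullet> preview w t k) + c'"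
  have c: "?J u = c + (\<Sum>j<k. E u j \<bullet> (S *v E u j))" for u
    by (simp only: c' c_def)
  define \<phi> where "\<phi> j y = - (K *v y) - G *v preview w (t + j) (k - j)" for j y
  define y where "y = rec_nat x (\<lambda>j y. A *v y + B *v \<phi> j y + w (t + j))"
  \<comment> \<open>The feedback \<open>\<phi>\<close> along its own trajectory \<open>y\<close>
    becomes an open-loop plan; \<open>undefined\<close> outside the window makes it
    extensional.\<close>
  define u where "u s = (if s \<in> {t..<t+k} then \<phi> (s - t) (y (s - t)) else undefined)" for s
  have "u \<in> ?U"
    by (simp add: u_def PiE_def extensional_def)
  have traj: "traj A B t x u w j = y j" if "j \<le> k" for j
    using that by (induction j) (auto simp: y_def u_def)
  have "E u j = 0" if "j < k" for j
    using that by (simp add: E_def traj deviation_def u_def \<phi>_def)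
  then have "?J u = c"
    by (simp add: c)
  have "c \<le> ?J v" for v
    unfolding c by (simp add: sum_nonneg S_nonneg)
  then have "is_arg_min ?J (\<lambda>u. u \<in> ?U) u"
    using \<open>u \<in> ?U\<close> \<open>?J u = c\<close> by (auto simp: is_arg_min_def not_less)
  \<comment> \<open>\<open>arg_min_on\<close> is a choice operator, so a minimizer has to be
    exhibited before anything is known about it.\<close>
  then have "is_arg_min ?J (\<lambda>u. u \<in> ?U) (mpc_plan A B Q R P k t x w)"
    unfolding mpc_plan_def arg_min_on_def arg_min_def by (rule someI[of "is_arg_min ?J (\<lambda>u. u \<in> ?U)"])
  then have "?J (mpc_plan A B Q R P k t x w) \<le> c"
    using \<open>u \<in> ?U\<close> \<open>?J u = c\<close> by (auto simp: is_arg_min_def not_less)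
  then have "(\<Sum>j<k. E (mpc_plan A B Q R P k t x w) j \<bullet> (S *v E (mpc_plan A B Q R P k t x w) j)) \<le> 0"
    by (simp add: c)
  then have "(\<Sum>j<k. E (mpc_plan A B Q R P k t x w) j \<bullet> (S *v E (mpc_plan A B Q R P k t x w) j)) = 0"
    by (intro antisym sum_nonneg S_nonneg)
  then have "E (mpc_plan A B Q R P k t x w) 0 \<bullet> (S *v E (mpc_plan A B Q R P k t x w) 0) = 0"
    using assms by (subst (asm) sum_nonneg_eq_0_iff) (auto simp: S_nonneg)
  then have "E (mpc_plan A B Q R P k t x w) 0 = 0"
    using S_pos by (metis less_irrefl)
  then show ?thesis
    by (simp add: E_def)
qed

section \<open>Regret of model predictive control\<close>

text \<open>What is lost after \<open>k\<close> predictions is a \<open>k\<close>-th power of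
  \<open>transpose F\<close> applied to a later preview. This is the source of
  \<open>matrix_power F k\<close> in the bound.\<close>

lemma preview_add: "preview w t (k + m) = preview w t k + ((*v) (transpose F) ^^ k) (preview w (t + k) m)"
  by (induction k arbitrary: t) (auto simp: preview_0 preview_Suc matrix_vector_right_distrib)

lemma preview_extend:
  assumes "\<forall>s\<ge>T. w s = 0" "T \<le> t + n"
  shows "preview w t (n + m) = preview w t n"
proof -
  have "preview w (t + n) m = 0"
    using assms by (simp add: preview_def linear_0[OF linear_funpow_mult_vec])
  then show ?thesis
    by (simp add: preview_add linear_0[OF linear_funpow_mult_vec])
qed

lemma preview_bound:
  assumes "spectral_radius F < 1"
  shows "\<exists>C>0. \<forall>w t k. (\<forall>s. norm (w s) \<le> W) \<longrightarrow> norm (preview w t k) \<le> C"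
proof -
  obtain C where C: "0 < C"
    "\<And>m d D. (\<forall>j. norm (d j) \<le> D) \<Longrightarrow> norm (\<Sum>j<m. ((*v) (transpose F) ^^ j) (d j)) \<le> C * D"
    using stable_sum_bound[of "transpose F"] assms unfolding spectral_radius_transpose by blast
  have "norm (preview w t k) \<le> C * (spectral_norm P * \<bar>W\<bar>) + 1" if w: "\<forall>s. norm (w s) \<le> W" for w t k
  proof -
    have "norm (P *v w (t + j)) \<le> spectral_norm P * \<bar>W\<bar>" for j
      using norm_mult_le_spectral_norm[of P "w (t + j)"] w spectral_norm_nonneg[of P]
      by (meson abs_ge_self mult_left_mono order_trans)
    then have "norm (preview w t k) \<le> C * (spectral_norm P * \<bar>W\<bar>)"
      unfolding preview_def by (intro C(2)) auto
    then show ?thesis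
      by simp
  qed
  moreover have "0 < C * (spectral_norm P * \<bar>W\<bar>) + 1"
    using C(1) spectral_norm_nonneg[of P] by (intro add_nonneg_pos mult_nonneg_nonneg) auto
  ultimately show ?thesis
    by blast
qed

lemma mpc_control_deviation:
  "1 \<le> k \<Longrightarrow> deviation (preview w t k) (mpc_state A B Q R P k x0 w t) (mpc_control A B Q R P k x0 w t) = 0"
  unfolding mpc_control_def by (rule mpc_plan_eq)

lemma traj_mpc_control: "traj A B 0 x0 (mpc_control A B Q R P k x0 w) w t = mpc_state A B Q R P k x0 w t"
  by (induction t) (auto simp: mpc_control_def)

text \<open>Expressing the control by its deviation turns the open-loop step into one of
  \<open>F\<close> with a forcing term; \<open>h\<close> is free, so previews of any length can be
  inserted.\<close>

lemma controlled_step: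
  "A *v x + B *v u + w = F *v x + (B *v deviation h x u - B *v (G *v h) + w)"
  by (simp add: F_mult_vec deviation_def matrix_vector_right_distrib)

text \<open>Relative to the preview of length \<open>k\<close> MPC has deviation zero, so its states
  follow \<open>F\<close> with a forcing bounded independently of \<open>k\<close> and
  \<open>t\<close>.\<close>

lemma mpc_state_bound:
  assumes "spectral_radius F < 1"
  shows "\<exists>C>0. \<forall>k w t. 1 \<le> k \<and> (\<forall>s. norm (w s) \<le> W) \<longrightarrow> norm (mpc_state A B Q R P k x0 w t) \<le> C"
proof -
  obtain H where H: "0 < H" "\<And>w t k. (\<forall>s. norm (w s) \<le> W) \<Longrightarrow> norm (preview w t k) \<le> H"
    using preview_bound[OF assms, of W] by blast
  obtain C where C: "0 < C" "\<And>x d D t. (\<forall>t. x (Suc t) = F *v x t + d t) \<and> (\<forall>t. norm (d t) \<le> D)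
      \<Longrightarrow> norm (x t) \<le> C * (norm (x 0) + D)"
    using stable_recurrence_bound[OF assms] by blast
  define D where "D = spectral_norm (B ** G) * H + \<bar>W\<bar>"
  have "norm (mpc_state A B Q R P k x0 w t) \<le> C * (norm x0 + D) + 1"
    if k: "1 \<le> k" and w: "\<forall>s. norm (w s) \<le> W" for k w t
  proof -
    let ?x = "mpc_state A B Q R P k x0 w"
    let ?d = "\<lambda>t. w t - B *v (G *v preview w t k)"
    have "?x (Suc t) = F *v ?x t + ?d t" for t
      using controlled_step[of "?x t" "mpc_control A B Q R P k x0 w t" "w t" "preview w t k"]
      by (simp add: mpc_control_deviation[OF k] mpc_control_def[symmetric])
    moreover have "norm (?d t) \<le> D" for t
    proof -
      have "norm ((B ** G) *v preview w t k) \<le> spectral_norm (B ** G) * H"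
        using norm_mult_le_spectral_norm[of "B ** G" "preview w t k"] H(2)[OF w, of t k]
          spectral_norm_nonneg[of "B ** G"] by (meson mult_left_mono order_trans)
      moreover have "norm (?d t) \<le> norm (w t) + norm ((B ** G) *v preview w t k)"
        by (simp add: matrix_vector_mul_assoc norm_triangle_ineq4)
      moreover have "norm (w t) \<le> \<bar>W\<bar>"
        using w by (meson abs_ge_self order_trans)
      ultimately show ?thesis
        by (simp add: D_def)
    qed
    ultimately have "norm (?x t) \<le> C * (norm (?x 0) + D)"
      by (intro C(2)[of ?x ?d]) blast
    then show ?thesis
      by simp
  qed
  moreover have "0 \<le> D"
    unfolding D_def using H(1) spectral_norm_nonneg[of "B ** G"] by (intro add_nonneg_nonneg mult_nonneg_nonneg) auto
  then have "0 < C * (norm x0 + D) + 1"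
    using C(1) by (intro add_nonneg_pos mult_nonneg_nonneg) auto
  ultimately show ?thesis
    by blast
qed

text \<open>The suboptimality of \<open>u\<close> for the terminal weight \<open>P\<close>. The
  preview length \<open>T - t\<close> is all that is left of the horizon, since in hindsight every
  disturbance is known.\<close>

definition excess :: "real^'n \<Rightarrow> (nat \<Rightarrow> real^'n) \<Rightarrow> nat \<Rightarrow> (nat \<Rightarrow> real^'d) \<Rightarrow> real" where
  "excess x0 w T u =
     (\<Sum>t<T. let e = deviation (preview w t (T - t)) (traj A B 0 x0 u w t) (u t) in e \<bullet> (S *v e))"

lemma window_cost_excess: "\<exists>V. \<forall>u. window_cost A B Q R P 0 T x0 u w = V + excess x0 w T u"
  using window_cost_completed_square[of 0 T w] unfolding excess_def add_0 by blast

lemma excess_mpc_bound: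
  assumes "spectral_radius F < 1"
  shows "\<exists>C>0. \<forall>k T w. 1 \<le> k \<and> (\<forall>s. norm (w s) \<le> W) \<and> (\<forall>s\<ge>T. w s = 0) \<longrightarrow>
    excess x0 w T (mpc_control A B Q R P k x0 w) \<le> C * ((spectral_norm (matrix_power F k))\<^sup>2 * real T)"
proof -
  obtain H where H: "0 < H" "\<And>w t k. (\<forall>s. norm (w s) \<le> W) \<Longrightarrow> norm (preview w t k) \<le> H"
    using preview_bound[OF assms, of W] by blast
  define C where "C = spectral_norm S * (spectral_norm G * H)\<^sup>2"
  have "excess x0 w T (mpc_control A B Q R P k x0 w) \<le> (C + 1) * ((spectral_norm (matrix_power F k))\<^sup>2 * real T)"
    if k: "1 \<le> k" and w: "\<forall>s. norm (w s) \<le> W" "\<forall>s\<ge>T. w s = 0" for k T w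
  proof -
    let ?f = "spectral_norm (matrix_power F k)"
    let ?e = "\<lambda>t. deviation (preview w t (T - t)) (mpc_state A B Q R P k x0 w t) (mpc_control A B Q R P k x0 w t)"
    have e: "norm (?e t) \<le> spectral_norm G * H * ?f" if "t < T" for t
    proof -
      \<comment> \<open>Lengthening the preview past the horizon adds only zeros and lets
        \<open>k\<close> predictions be split off whether or not \<open>k\<close> exceeds
        \<open>T - t\<close>.\<close>
      have "preview w t (T - t) = preview w t (k + (T - t))"
        using preview_extend[OF w(2), of t "T - t" k] that by (simp add: add.commute)
      also have "\<dots> = preview w t k + transpose (matrix_power F k) *v preview w (t + k) (T - t)"
        by (simp add: preview_add transpose_matrix_power)
      finally have "?e t = deviation (preview w t k) (mpc_state A B Q R P k x0 w t) (mpc_control A B Q R P k x0 w t)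
          + G *v (transpose (matrix_power F k) *v preview w (t + k) (T - t))"
        by (simp add: deviation_def matrix_vector_right_distrib)
      also have "\<dots> = G *v (transpose (matrix_power F k) *v preview w (t + k) (T - t))"
        by (simp add: mpc_control_deviation[OF k])
      finally have le: "norm (?e t) \<le> spectral_norm G * norm (transpose (matrix_power F k) *v preview w (t + k) (T - t))"
        by (simp only: norm_mult_le_spectral_norm)
      have bound: "norm (transpose (matrix_power F k) *v preview w (t + k) (T - t)) \<le> ?f * H"
        using norm_mult_transpose_le_spectral_norm H(2)[OF w(1)] spectral_norm_nonneg
        by (meson mult_left_mono order_trans)
      show ?thesis
        using order_trans[OF le mult_left_mono[OF bound spectral_norm_nonneg]] by (simp add: mult_ac)
    qed
    have "excess x0 w T (mpc_control A B Q R P k x0 w) \<le> (\<Sum>t<T. C * ?f\<^sup>2)"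
      unfolding excess_def Let_def traj_mpc_control
    proof (intro sum_mono)
      fix t assume "t \<in> {..<T}"
      then have "(norm (?e t))\<^sup>2 \<le> (spectral_norm G * H * ?f)\<^sup>2"
        using e[of t] by (intro power_mono) auto
      then have "spectral_norm S * (norm (?e t))\<^sup>2 \<le> C * ?f\<^sup>2"
        using spectral_norm_nonneg[of S] by (simp add: C_def power_mult_distrib mult_left_mono mult.assoc)
      moreover have "?e t \<bullet> (S *v ?e t) \<le> spectral_norm S * (norm (?e t))\<^sup>2"
        using quadratic_form_le[of "?e t" S "?e t"] by (simp add: power2_eq_square mult.assoc)
      ultimately show "?e t \<bullet> (S *v ?e t) \<le> C * ?f\<^sup>2"
        by simp
    qed
    also have "\<dots> \<le> (C + 1) * (?f\<^sup>2 * real T)"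
      by (simp add: algebra_simps)
    finally show ?thesis .
  qed
  moreover have "0 < C + 1"
    using spectral_norm_nonneg[of S] by (simp add: C_def add_nonneg_pos)
  ultimately show ?thesis
    by blast
qed

section \<open>Exchange of the terminal weight\<close>

lemma homogeneous_cost:
  "window_cost A B Q R P 0 T 0 v (\<lambda>_. 0)
    = (\<Sum>t<T. let e = v t + K *v traj A B 0 0 v (\<lambda>_. 0) t in e \<bullet> (S *v e))"
proof -
  let ?w = "\<lambda>_. 0 :: real^'n"
  have preview: "preview ?w t k = 0" for t k
    by (simp add: preview_def linear_0[OF linear_funpow_mult_vec])
  have "traj A B 0 0 (\<lambda>_. 0) ?w t = 0" for t
    by (induction t) auto
  \<comment> \<open>Zero control from the origin has zero cost and zero excess; this identifies the
    constant \<open>V\<close> below as zero.\<close>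
  then have 0: "window_cost A B Q R P 0 T 0 (\<lambda>_. 0) ?w = 0" "excess 0 ?w T (\<lambda>_. 0) = 0"
    by (simp_all add: window_cost_def excess_def deviation_def preview)
  obtain V where V: "\<And>u. window_cost A B Q R P 0 T 0 u ?w = V + excess 0 ?w T u"
    using window_cost_excess by blast
  then have "V = 0"
    using V[of "\<lambda>_. 0"] 0 by simp
  then show ?thesis
    using V by (simp add: excess_def deviation_def preview)
qed

text \<open>Relative to the trajectory without deviation, the terminal state moves by the response
  \<open>\<xi>\<close> of the undisturbed system. Its cost equals the excess and, by detectability, controls
  \<open>\<xi>\<close> at the final time uniformly in the horizon.\<close>

lemma terminal_weight_le_excess:
  assumes "detectable A Q"
  shows "\<exists>C>0. \<forall>T w u. (\<forall>s. norm (w s) \<le> W) \<longrightarrow>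
    traj A B 0 x0 u w T \<bullet> (P *v traj A B 0 x0 u w T) \<le> excess x0 w T u + C"
proof -
  note stable = spectral_radius_closed_loop[OF assms]
  obtain L where L: "spectral_radius (A - L ** Q) < 1"
    using detectable_output_injection[OF assms Q] by blast
  obtain H where H: "0 < H" "\<And>w t k. (\<forall>s. norm (w s) \<le> W) \<Longrightarrow> norm (preview w t k) \<le> H"
    using preview_bound[OF stable, of W] by blast
  obtain C1 where C1: "0 < C1" "\<And>x d D t. (\<forall>t. x (Suc t) = F *v x t + d t) \<and> (\<forall>t. norm (d t) \<le> D)
      \<Longrightarrow> norm (x t) \<le> C1 * (norm (x 0) + D)"
    using stable_recurrence_bound[OF stable] by blast
  obtain C2 where C2: "0 < C2" "\<And>x d T. x 0 = 0 \<and> (\<forall>t<T. x (Suc t) = (A - L ** Q) *v x t + d t)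
      \<Longrightarrow> (norm (x T))\<^sup>2 \<le> C2 * (\<Sum>t<T. (norm (d t))\<^sup>2)"
    using stable_recurrence_square_sum_bound[OF L] by blast
  obtain cR where cR: "0 < cR" "\<And>v. (norm v)\<^sup>2 \<le> cR * (v \<bullet> (R *v v))"
    using pos_def_coercive[OF R] by blast
  define D where "D = spectral_norm (B ** G) * H + \<bar>W\<bar>"
  define X where "X = C1 * (norm x0 + D)"
  \<comment> \<open>From \<open>(a + b)\<^sup>2 \<le> 2 * a\<^sup>2 + 2 * b\<^sup>2\<close> for the
    injected output and the input; \<open>c\<close> dominates the coefficients of both stage
    costs.\<close>
  define c where "c = 2 * (spectral_norm L)\<^sup>2 * (spectral_norm Q + 1) + 2 * (spectral_norm B)\<^sup>2 * cR + 1"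
  have c: "0 < c"
    unfolding c_def using spectral_norm_nonneg[of Q] cR(1)
    by (intro add_nonneg_pos add_nonneg_nonneg mult_nonneg_nonneg) auto
  define p where "p = spectral_norm P"
  have p: "0 \<le> p"
    by (simp add: p_def spectral_norm_nonneg)
  define C where "C = p * X\<^sup>2 + C2 * c * (p * X)\<^sup>2"
  have "traj A B 0 x0 u w T \<bullet> (P *v traj A B 0 x0 u w T) \<le> excess x0 w T u + (C + 1)"
    if w: "\<forall>s. norm (w s) \<le> W" for T w u
  proof -
    let ?h = "\<lambda>t. preview w t (T - t)"
    let ?d = "\<lambda>t. w t - B *v (G *v ?h t)"
    define x where "x = traj A B 0 x0 u w"
    define e where "e t = deviation (?h t) (x t) (u t)" for t
    define y where "y = rec_nat x0 (\<lambda>t y. F *v y + ?d t)"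
    define \<xi> where "\<xi> t = x t - y t" for t
    \<comment> \<open>The input that generates \<open>\<xi>\<close> in open loop, as
      \<open>F *v \<xi> t + B *v e t\<close> equals \<open>A *v \<xi> t + B *v v t\<close>. Since
      \<open>v t + K *v \<xi> t\<close> is \<open>e t\<close>, its homogeneous cost is the
      excess.\<close>
    define v where "v t = e t - K *v \<xi> t" for t
    have x_Suc: "x (Suc t) = F *v x t + (B *v e t + ?d t)" for t
      unfolding x_def e_def using controlled_step[of "traj A B 0 x0 u w t" "u t" "w t" "?h t"] by simp
    have y_Suc: "y (Suc t) = F *v y t + ?d t" for t
      by (simp add: y_def)
    have \<xi>_Suc: "\<xi> (Suc t) = A *v \<xi> t + B *v v t" for t
      unfolding \<xi>_def v_def x_Suc y_Suc
      by (simp add: F_mult_vec matrix_vector_mult_diff_distrib)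
    have \<xi>_0: "\<xi> 0 = 0"
      by (simp add: \<xi>_def x_def y_def)
    have \<xi>_traj: "traj A B 0 0 v (\<lambda>_. 0) t = \<xi> t" for t
      by (induction t) (auto simp: \<xi>_0 \<xi>_Suc)
    have "norm (?d t) \<le> D" for t
    proof -
      have "norm ((B ** G) *v ?h t) \<le> spectral_norm (B ** G) * H"
        using norm_mult_le_spectral_norm[of "B ** G" "?h t"] H(2)[OF w, of t "T - t"]
          spectral_norm_nonneg[of "B ** G"] by (meson mult_left_mono order_trans)
      moreover have "norm (?d t) \<le> norm (w t) + norm ((B ** G) *v ?h t)"
        by (simp add: matrix_vector_mul_assoc norm_triangle_ineq4)
      moreover have "norm (w t) \<le> \<bar>W\<bar>"
        using w by (meson abs_ge_self order_trans)
      ultimately show ?thesis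
        by (simp add: D_def)
    qed
    then have y: "norm (y t) \<le> X" for t
      using C1(2)[of y ?d D t] y_Suc by (simp add: X_def y_def)
    define cost where "cost = (\<Sum>t<T. \<xi> t \<bullet> (Q *v \<xi> t) + v t \<bullet> (R *v v t))"
    have "excess x0 w T u = (\<Sum>t<T. e t \<bullet> (S *v e t))"
      by (simp add: excess_def e_def x_def Let_def)
    also have "\<dots> = window_cost A B Q R P 0 T 0 v (\<lambda>_. 0)"
      by (simp add: homogeneous_cost \<xi>_traj v_def Let_def)
    also have "\<dots> = cost + \<xi> T \<bullet> (P *v \<xi> T)"
      by (simp add: window_cost_def \<xi>_traj cost_def)
    finally have excess: "excess x0 w T u = cost + \<xi> T \<bullet> (P *v \<xi> T)" .
    have step: "(norm (L *v (Q *v \<xi> t) + B *v v t))\<^sup>2 \<le> c * (\<xi> t \<bullet> (Q *v \<xi> t) + v t \<bullet> (R *v v t))" for t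
    proof -
      let ?a = "norm (L *v (Q *v \<xi> t))" and ?b = "norm (B *v v t)"
      have qr: "0 \<le> \<xi> t \<bullet> (Q *v \<xi> t)" "0 \<le> v t \<bullet> (R *v v t)"
        using pos_semidef_nonneg Q pos_def_imp_pos_semidef[OF R] by blast+
      have "?a\<^sup>2 \<le> (spectral_norm L * norm (Q *v \<xi> t))\<^sup>2"
        by (intro power_mono norm_mult_le_spectral_norm) auto
      also have "\<dots> \<le> (spectral_norm L)\<^sup>2 * ((spectral_norm Q + 1) * (\<xi> t \<bullet> (Q *v \<xi> t)))"
        unfolding power_mult_distrib by (intro mult_left_mono norm_pos_semidef_mult_le Q) auto
      finally have a: "?a\<^sup>2 \<le> (spectral_norm L)\<^sup>2 * (spectral_norm Q + 1) * (\<xi> t \<bullet> (Q *v \<xi> t))"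
        by (simp only: mult.assoc)
      have "?b\<^sup>2 \<le> (spectral_norm B * norm (v t))\<^sup>2"
        by (intro power_mono norm_mult_le_spectral_norm) auto
      also have "\<dots> \<le> (spectral_norm B)\<^sup>2 * (cR * (v t \<bullet> (R *v v t)))"
        unfolding power_mult_distrib by (intro mult_left_mono cR) auto
      finally have b: "?b\<^sup>2 \<le> (spectral_norm B)\<^sup>2 * cR * (v t \<bullet> (R *v v t))"
        by (simp only: mult.assoc)
      have "(norm (L *v (Q *v \<xi> t) + B *v v t))\<^sup>2 \<le> (?a + ?b)\<^sup>2"
        by (intro power_mono norm_triangle_ineq) auto
      also have "\<dots> \<le> 2 * ?a\<^sup>2 + 2 * ?b\<^sup>2"
        using sum_squares_bound[of ?a ?b] by (simp add: power2_sum)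
      also have "\<dots> \<le> 2 * (spectral_norm L)\<^sup>2 * (spectral_norm Q + 1) * (\<xi> t \<bullet> (Q *v \<xi> t))
          + 2 * (spectral_norm B)\<^sup>2 * cR * (v t \<bullet> (R *v v t))"
        using a b by simp
      also have "\<dots> \<le> c * (\<xi> t \<bullet> (Q *v \<xi> t)) + c * (v t \<bullet> (R *v v t))"
        using qr cR(1) spectral_norm_nonneg[of Q] unfolding c_def
        by (intro add_mono mult_right_mono) (auto simp: add_nonneg_nonneg)
      finally show ?thesis
        by (simp only: distrib_left)
    qed
    \<comment> \<open>Output injection replaces \<open>A\<close> by a stable matrix, at the price of
      a forcing that the stage costs control.\<close>
    have "\<xi> (Suc t) = (A - L ** Q) *v \<xi> t + (L *v (Q *v \<xi> t) + B *v v t)" for t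
      by (simp add: \<xi>_Suc matrix_vector_mult_diff_rdistrib matrix_vector_mul_assoc)
    then have "(norm (\<xi> T))\<^sup>2 \<le> C2 * (\<Sum>t<T. (norm (L *v (Q *v \<xi> t) + B *v v t))\<^sup>2)"
      using \<xi>_0 by (intro C2(2)[of \<xi>]) blast
    also have "\<dots> \<le> C2 * (\<Sum>t<T. c * (\<xi> t \<bullet> (Q *v \<xi> t) + v t \<bullet> (R *v v t)))"
      using C2(1) by (intro mult_left_mono sum_mono step) auto
    finally have \<xi>: "(norm (\<xi> T))\<^sup>2 \<le> C2 * c * cost"
      by (simp add: cost_def sum_distrib_left mult.assoc)
    have yy: "y T \<bullet> (P *v y T) \<le> p * X\<^sup>2"
    proof -
      have "y T \<bullet> (P *v y T) \<le> p * (norm (y T))\<^sup>2"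
        using quadratic_form_le[of "y T" P "y T"] by (simp add: p_def power2_eq_square mult.assoc)
      also have "\<dots> \<le> p * X\<^sup>2"
        using p y[of T] by (intro mult_left_mono power_mono) auto
      finally show ?thesis .
    qed
    have "y T \<bullet> (P *v \<xi> T) \<le> p * norm (y T) * norm (\<xi> T)"
      using quadratic_form_le[of "y T" P "\<xi> T"] by (simp add: p_def)
    also have "\<dots> \<le> p * X * norm (\<xi> T)"
      using p y[of T] by (intro mult_right_mono mult_left_mono) auto
    finally have "2 * (y T \<bullet> (P *v \<xi> T)) \<le> 2 * (p * X) * norm (\<xi> T)"
      by simp
    \<comment> \<open>Young's inequality, weighted so that the last summand is at most
      \<open>cost\<close>.\<close>
    also have "\<dots> \<le> C2 * c * (p * X)\<^sup>2 + (norm (\<xi> T))\<^sup>2 / (C2 * c)"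
    proof -
      have "0 \<le> (C2 * c * (p * X) - norm (\<xi> T))\<^sup>2 / (C2 * c)"
        using C2(1) c by simp
      also have "\<dots> = C2 * c * (p * X)\<^sup>2 + (norm (\<xi> T))\<^sup>2 / (C2 * c) - 2 * (p * X) * norm (\<xi> T)"
        using C2(1) c by (simp add: power2_diff diff_divide_distrib add_divide_distrib) (simp add: power2_eq_square)
      finally show ?thesis
        by simp
    qed
    also have "(norm (\<xi> T))\<^sup>2 / (C2 * c) \<le> cost"
      using \<xi> C2(1) c by (simp add: divide_le_eq mult_ac)
    finally have cross: "2 * (y T \<bullet> (P *v \<xi> T)) \<le> C2 * c * (p * X)\<^sup>2 + cost"
      by simp
    have "x T = y T + \<xi> T"
      by (simp add: \<xi>_def)
    \<comment> \<open>The form at \<open>\<xi> T\<close> occurs in \<open>excess\<close> with the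
      same coefficient 1; the rest of \<open>excess\<close>, namely \<open>cost\<close>, pays for
      the cross term.\<close>
    then have "x T \<bullet> (P *v x T) = y T \<bullet> (P *v y T) + 2 * (y T \<bullet> (P *v \<xi> T)) + \<xi> T \<bullet> (P *v \<xi> T)"
      using pos_semidef_inner_commute[OF P, of "\<xi> T" "y T"]
      by (simp add: matrix_vector_right_distrib inner_add_left inner_add_right)
    then show ?thesis
      unfolding x_def[symmetric] excess C_def using yy cross by linarith
  qed
  moreover have "0 < C + 1"
    unfolding C_def using p C2(1) c by (intro add_nonneg_pos add_nonneg_nonneg mult_nonneg_nonneg) auto
  ultimately show ?thesis
    by blast
qed

text \<open>Both costs share the constant \<open>V\<close>. For MPC the \<open>P\<close>-form is
  dropped and the state bound limits the \<open>Qf\<close>-form; for the competitor the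
  \<open>Qf\<close>-form is dropped and the excess pays for the \<open>P\<close>-form. As
  \<open>u\<close> is arbitrary, the bound passes to the infimum.\<close>

lemma regret_le:
  assumes "detectable A Q" "pos_semidef Qf"
  shows "\<exists>C>0. \<forall>k T w u. 1 \<le> k \<and> (\<forall>s. norm (w s) \<le> W) \<and> (\<forall>s\<ge>T. w s = 0) \<longrightarrow>
    total_cost A B Q R Qf x0 T (mpc_control A B Q R P k x0 w) w - total_cost A B Q R Qf x0 T u w
      \<le> C * ((spectral_norm (matrix_power F k))\<^sup>2 * real T + 1)"
proof -
  note stable = spectral_radius_closed_loop[OF assms(1)]
  obtain C1 where C1: "0 < C1" "\<And>k T w. 1 \<le> k \<and> (\<forall>s. norm (w s) \<le> W) \<and> (\<forall>s\<ge>T. w s = 0) \<Longrightarrow>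
    excess x0 w T (mpc_control A B Q R P k x0 w) \<le> C1 * ((spectral_norm (matrix_power F k))\<^sup>2 * real T)"
    using excess_mpc_bound[OF stable, of W x0] by blast
  obtain C2 where C2: "0 < C2" "\<And>k w t. 1 \<le> k \<and> (\<forall>s. norm (w s) \<le> W) \<Longrightarrow> norm (mpc_state A B Q R P k x0 w t) \<le> C2"
    using mpc_state_bound[OF stable, of W x0] by blast
  obtain C3 where C3: "0 < C3" "\<And>T w u. (\<forall>s. norm (w s) \<le> W) \<Longrightarrow>
    traj A B 0 x0 u w T \<bullet> (P *v traj A B 0 x0 u w T) \<le> excess x0 w T u + C3"
    using terminal_weight_le_excess[OF assms(1), of W x0] by blast
  define C where "C = C1 + spectral_norm Qf * C2\<^sup>2 + C3"
  have nonneg: "0 \<le> spectral_norm Qf * C2\<^sup>2"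
    using spectral_norm_nonneg[of Qf] by simp
  have "total_cost A B Q R Qf x0 T (mpc_control A B Q R P k x0 w) w - total_cost A B Q R Qf x0 T u w
      \<le> C * ((spectral_norm (matrix_power F k))\<^sup>2 * real T + 1)"
    if k: "1 \<le> k" and w: "\<forall>s. norm (w s) \<le> W" "\<forall>s\<ge>T. w s = 0" for k T w u
  proof -
    let ?m = "mpc_control A B Q R P k x0 w" and ?f = "(spectral_norm (matrix_power F k))\<^sup>2 * real T"
    obtain V where V: "\<And>u. window_cost A B Q R P 0 T x0 u w = V + excess x0 w T u"
      using window_cost_excess by blast
    have terminal: "total_cost A B Q R Qf x0 T u w = V + excess x0 w T u
      - traj A B 0 x0 u w T \<bullet> (P *v traj A B 0 x0 u w T) + traj A B 0 x0 u w T \<bullet> (Qf *v traj A B 0 x0 u w T)" for u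
      using V[of u] by (simp add: total_cost_def window_cost_def)
    let ?x = "mpc_state A B Q R P k x0 w T"
    have "?x \<bullet> (Qf *v ?x) \<le> spectral_norm Qf * (norm ?x)\<^sup>2"
      using quadratic_form_le[of ?x Qf ?x] by (simp add: power2_eq_square mult.assoc)
    also have "\<dots> \<le> spectral_norm Qf * C2\<^sup>2"
      using C2(2) k w(1) spectral_norm_nonneg[of Qf] by (intro mult_left_mono power_mono) auto
    finally have "total_cost A B Q R Qf x0 T ?m w \<le> V + C1 * ?f + spectral_norm Qf * C2\<^sup>2"
      using terminal[of ?m] C1(2)[of k w T] k w pos_semidef_nonneg[OF P, of ?x] unfolding traj_mpc_control
      by simp
    moreover have "V - C3 \<le> total_cost A B Q R Qf x0 T u w"
      using terminal[of u] C3(2)[OF w(1), of u T] pos_semidef_nonneg[OF assms(2), of "traj A B 0 x0 u w T"]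
      by simp
    ultimately have "total_cost A B Q R Qf x0 T ?m w - total_cost A B Q R Qf x0 T u w
        \<le> C1 * ?f + (spectral_norm Qf * C2\<^sup>2 + C3)"
      by simp
    also have "\<dots> \<le> C * ?f + C"
      unfolding C_def using C1(1) C3(1) nonneg by (intro add_mono mult_right_mono) auto
    finally show ?thesis
      by (simp add: distrib_left)
  qed
  moreover have "0 < C"
    unfolding C_def using C1(1) C3(1) nonneg by simp
  ultimately show ?thesis
    by blast
qed

end

section \<open>Passage to the supremum over disturbances\<close>

lemma total_cost_nonneg:
  assumes "pos_semidef Q" "pos_semidef Qf" "pos_def R"
  shows "0 \<le> total_cost A B Q R Qf x0 T u w"
  unfolding total_cost_def window_cost_def
  by (intro add_nonneg_nonneg sum_nonneg pos_semidef_nonneg pos_def_imp_pos_semidef assms)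

theorem theorem5p5:
  fixes A Q Qf P F :: "real^'n^'n"
    and B :: "real^'d^'n"
    and R :: "real^'d^'d"
    and x0 :: "real^'n"
    and \<Omega> :: "(real^'n) set"
    and lam :: real
  assumes "pos_semidef Q" and "pos_semidef Qf" and "pos_def R"
    and "stabilizable A B" and "detectable A Q"
    and "pos_semidef P" and "solves_riccati A B Q R P"
    and "F = A - B ** riccati_gain A B R P"
    and "lam = (1 + spectral_radius F) / 2"
    and "bounded \<Omega>" and "\<Omega> \<noteq> {}"
  shows
    "(\<exists>C>0. \<forall>k T. 1 \<le> k \<and> k \<le> T \<longrightarrow>
        \<bar>mpc_dynamic_regret A B Q R Qf P x0 \<Omega> k T\<bar>
          \<le> ereal (C * ((spectral_norm (matrix_power F k))\<^sup>2 * real T + 1)))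
     \<and> (\<exists>C>0. \<forall>k T. 1 \<le> k \<and> k \<le> T \<longrightarrow>
        \<bar>(spectral_norm (matrix_power F k))\<^sup>2 * real T + 1\<bar>
          \<le> C * (lam ^ (2 * k) * real T + 1))
     \<and> (\<exists>C>0. \<forall>k T. 1 \<le> k \<and> k \<le> T \<longrightarrow>
        \<bar>mpc_dynamic_regret A B Q R Qf P x0 \<Omega> k T\<bar>
          \<le> ereal (C * (lam ^ (2 * k) * real T + 1)))"
proof -
  interpret ric: riccati_solution A Q P B R
    using assms by unfold_locales
  have F: "ric.F = F"
    by (simp add: ric.F_def ric.K_def assms(8))
  have "spectral_radius F < 1"
    using ric.spectral_radius_closed_loop[OF assms(5)] by (simp add: F)
  \<comment> \<open>The midpoint of the spectral radius and 1 exceeds the former because the former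
    is below 1.\<close>
  then have "spectral_radius F < lam"
    by (simp add: assms(9))
  then obtain C0 where C0: "0 < C0" "\<And>k. spectral_norm (matrix_power F k) \<le> C0 * lam ^ k"
    using spectral_norm_matrix_power_bound by blast
  obtain W where W: "0 < W" "\<And>x. x \<in> \<Omega> \<Longrightarrow> norm x \<le> W"
    using assms(10) unfolding bounded_pos by blast
  obtain C where C: "0 < C" "\<And>k T w u. 1 \<le> k \<and> (\<forall>s. norm (w s) \<le> W) \<and> (\<forall>s\<ge>T. w s = 0) \<Longrightarrow>
    total_cost A B Q R Qf x0 T (mpc_control A B Q R P k x0 w) w - total_cost A B Q R Qf x0 T u w
      \<le> C * ((spectral_norm (matrix_power F k))\<^sup>2 * real T + 1)"
    using ric.regret_le[OF assms(5,2), of W x0] unfolding F by blast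
  have regret: "\<bar>mpc_dynamic_regret A B Q R Qf P x0 \<Omega> k T\<bar>
      \<le> ereal (C * ((spectral_norm (matrix_power F k))\<^sup>2 * real T + 1))" if k: "1 \<le> k" for k T
  proof -
    let ?b = "C * ((spectral_norm (matrix_power F k))\<^sup>2 * real T + 1)"
    let ?r = "\<lambda>w. total_cost A B Q R Qf x0 T (mpc_control A B Q R P k x0 w) w
      - (INF u. total_cost A B Q R Qf x0 T u w)"
    \<comment> \<open>MPC is one of the competitors; this lower bound handles the absolute value of
      the regret.\<close>
    have "0 \<le> ?r w" for w
    proof -
      have "bdd_below (range (\<lambda>u. total_cost A B Q R Qf x0 T u w))"
        using total_cost_nonneg[OF assms(1-3)] by (intro bdd_belowI[of _ 0]) auto
      then have "(INF u. total_cost A B Q R Qf x0 T u w) \<le> total_cost A B Q R Qf x0 T (mpc_control A B Q R P k x0 w) w"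
        by (rule cINF_lower) simp
      then show ?thesis
        by simp
    qed
    moreover have "?r w \<le> ?b" if w: "w \<in> disturbances \<Omega> T" for w
    proof -
      have "norm (w s) \<le> W" for s
        using w W by (cases "s < T") (auto simp: disturbances_def)
      moreover have "\<forall>s\<ge>T. w s = 0"
        using w by (simp add: disturbances_def)
      ultimately have "total_cost A B Q R Qf x0 T (mpc_control A B Q R P k x0 w) w - ?b
          \<le> total_cost A B Q R Qf x0 T u w" for u
        using C(2)[of k w T u] k by auto
      then have "total_cost A B Q R Qf x0 T (mpc_control A B Q R P k x0 w) w - ?b
          \<le> (INF u. total_cost A B Q R Qf x0 T u w)"
        by (intro cINF_greatest) auto
      then show ?thesis
        by simp
    qed
    \<comment> \<open>A lower bound on the supremum needs an admissible disturbance, since over the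
      empty set it would be \<open>-\<infinity>\<close>.\<close>
    moreover obtain x where "x \<in> \<Omega>"
      using assms(11) by blast
    then have "(\<lambda>t. if t < T then x else 0) \<in> disturbances \<Omega> T"
      by (simp add: disturbances_def)
    ultimately have "0 \<le> mpc_dynamic_regret A B Q R Qf P x0 \<Omega> k T"
      "mpc_dynamic_regret A B Q R Qf P x0 \<Omega> k T \<le> ereal ?b"
      unfolding mpc_dynamic_regret_def by (auto intro!: SUP_upper2 SUP_least)
    then show ?thesis
      by simp
  qed
  \<comment> \<open>In the constant, \<open>C0\<^sup>2\<close> serves the term in \<open>T\<close>
    and 1 the additive term.\<close>
  have decay: "\<bar>(spectral_norm (matrix_power F k))\<^sup>2 * real T + 1\<bar> \<le> (C0\<^sup>2 + 1) * (lam ^ (2 * k) * real T + 1)" for k T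
  proof -
    have "(spectral_norm (matrix_power F k))\<^sup>2 \<le> (C0 * lam ^ k)\<^sup>2"
      by (intro power_mono C0(2) spectral_norm_nonneg)
    also have "\<dots> = C0\<^sup>2 * lam ^ (2 * k)"
      by (simp add: power_mult_distrib power_mult[symmetric] mult.commute)
    finally have "(spectral_norm (matrix_power F k))\<^sup>2 * real T \<le> C0\<^sup>2 * lam ^ (2 * k) * real T"
      by (intro mult_right_mono) auto
    moreover have "0 \<le> lam ^ (2 * k) * real T"
      by (simp add: power_mult)
    ultimately have "(spectral_norm (matrix_power F k))\<^sup>2 * real T + 1 \<le> (C0\<^sup>2 + 1) * (lam ^ (2 * k) * real T + 1)"
      using zero_le_power2[of C0] unfolding distrib_left distrib_right mult.assoc by linarith
    then show ?thesis
      by simp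
  qed
  have "\<bar>mpc_dynamic_regret A B Q R Qf P x0 \<Omega> k T\<bar>
      \<le> ereal (C * (C0\<^sup>2 + 1) * (lam ^ (2 * k) * real T + 1))" if "1 \<le> k" for k T
  proof -
    have "C * ((spectral_norm (matrix_power F k))\<^sup>2 * real T + 1) \<le> C * ((C0\<^sup>2 + 1) * (lam ^ (2 * k) * real T + 1))"
      using decay[of k T] C(1) by (intro mult_left_mono) auto
    then show ?thesis
      using regret[OF that, of T] by (simp only: mult.assoc) (metis ereal_less_eq(3) order_trans)
  qed
  moreover have "0 < C0\<^sup>2 + 1"
    by (simp add: add_nonneg_pos)
  moreover from this have "0 < C * (C0\<^sup>2 + 1)"
    using C(1) by (rule mult_pos_pos[rotated])
  ultimately show ?thesis
    using C(1) regret decay by (intro conjI) (blast intro: exI)+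
qed

end
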